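(* Let $P$ be a join-factorization lattice, let $\mathcal{M}$ be a good model category, let $F\colon P\to\mathcal{M}$ be a functor, and let $n\ge 0$ be an integer. If $F$ is codegree $n$, then the canonical map $\varepsilon_n\colon T_nF\to F$ is an objectwise weak equivalence (in particular $T_nF\simeq F$).
   Context: A lattice is a poset with all binary joins $\vee$ and meets $\wedge$, viewed as a category; it is distributive if $x\wedge(y\vee z)=(x\wedge y)\vee(x\wedge z)$ for all $x,y,z$. Cubes. Let $[n]=\{0,\dots,n\}$ and let $\mathcal{P}_{n+1}$ be the power set of $[n]$ ordered by inclusion. An $(n+1)$-cube in a category $C$ is a functor $\mathcal{X}\colon\mathcal{P}_{n+1}\to C$. It is cocartesian if $\operatorname{colim}_{S\subsetneq[n]}\mathcal{X}(S)\to\mathcal{X}([n])$ is an isomorphism, and cartesian if $\mathcal{X}(\emptyset)\to\lim_{\emptyset\ne S\subseteq[n]}\mathcal{X}(S)$ is an isomorphism. It is strongly bicartesian if every face of dimension $\ge 2$ is both cartesian and cocartesian (so every 1-cube is strongly bicartesian). A cube in a model category is homotopy cocartesian if $\operatorname{hocolim}_{S\subsetneq[n]}\mathcal{X}(S)\to\mathcal{X}([n])$ is a weak equivalence. A model category $\mathcal{M}$ is good if $\operatorname{Fun}(P,\mathcal{M})$ admits the projective model structure for every poset $P$. A functor $F\colon P\to\mathcal{M}$ from a lattice to a good model category is codegree $n$ if for every strongly bicartesian $(n+1)$-cube $\mathcal{X}$ in $P$, the cube $F\circ\mathcal{X}$ is homotopy cocartesian. Join-dimension. Let $P$ be a distributive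 lattice. An element $v$ is join-irreducible if there are no $x,y<v$ with $v=x\vee y$. A join-decomposition of $v$ of size $k$ is a finite collection $p^0,\dots,p^{k-1}$ with $v=p^0\vee\dots\vee p^{k-1}$; it is reduced if omitting any one $p^i$ gives a join different from $v$ (by convention the size 1 decomposition $p^0=v$ is reduced unless $v$ is minimal), and indecomposable if all $p^i$ are join-irreducible. An indecomposable reduced join-decomposition is unique if it exists. Put $\operatorname{jdim}(v)=0$ if $v$ is minimal in $P$; $\operatorname{jdim}(v)=k$ if $v$ is not minimal and has a reduced indecomposable join-decomposition of size $k$; and $\operatorname{jdim}(v)=\infty$ otherwise. Let $P_{\le k}=\{v\in P:\operatorname{jdim}(v)\le k\}$. A join-factorization lattice is a distributive lattice $P$ with a minimal element for which there exist a distributive lattice $Q$ satisfying the descending chain condition (every nonempty subset of $Q$ has a minimal element) and an order-preserving function $f\colon P\to Q$ with $\operatorname{jdim}(f(v))=\operatorname{jdim}(v)$ for all $v\in P$. The codegree $k$ approximation $T_kF$ of $F\colon P\to\mathcal{M}$ is the homotopy left Kan extension of $F|_{P_{\le k}}$ along the inclusion $P_{\le k}\hookrightarrow P$; on objects $T_kF(x)=\operatorname{hocolim}_{v\in P_{\le k},\,v\le x}F(v)$. The map $\varepsilon_k\colon T_kF\to F$ is the canonical comparison map. Concretely: if $q_k\colon Q_k\to F|_{P_{\le k}}$ is a projectively cofibrant replacement, then $T_kF$ is the left Kan extension of $Q_k$ along $P_{\le k}\hookrightarrow P$ and $\varepsilon_k$ is the map corresponding to $q_k$ under the universal property. *)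

theory Defs
  imports "HOL-Library.FuncSet" "HOL-Library.Extended_Nat"
begin

section \<open>Categories, functors, limits and colimits\<close>

record ('o, 'a) cat =
  Ob :: "'o set"
  Arr :: "'a set"
  Dom :: "'a \<Rightarrow> 'o"
  Cod :: "'a \<Rightarrow> 'o"
  Ide :: "'o \<Rightarrow> 'a"
  Comp :: "'a \<Rightarrow> 'a \<Rightarrow> 'a"  (* Comp C g f is g after f *)

definition Hom :: "('o, 'a, 'm) cat_scheme \<Rightarrow> 'o \<Rightarrow> 'o \<Rightarrow> 'a set" where
  "Hom C x y = {f \<in> Arr C. Dom C f = x \<and> Cod C f = y}"

definition category :: "('o, 'a, 'm) cat_scheme \<Rightarrow> bool" where
  "category C \<longleftrightarrow>
     (\<forall>f\<in>Arr C. Dom C f \<in> Ob C \<and> Cod C f \<in> Ob C) \<and>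
     (\<forall>x\<in>Ob C. Ide C x \<in> Hom C x x) \<and>
     (\<forall>f\<in>Arr C. \<forall>g\<in>Arr C. Cod C f = Dom C g \<longrightarrow> Comp C g f \<in> Hom C (Dom C f) (Cod C g)) \<and>
     (\<forall>f\<in>Arr C. Comp C f (Ide C (Dom C f)) = f \<and> Comp C (Ide C (Cod C f)) f = f) \<and>
     (\<forall>f\<in>Arr C. \<forall>g\<in>Arr C. \<forall>h\<in>Arr C. Cod C f = Dom C g \<longrightarrow> Cod C g = Dom C h \<longrightarrow>
        Comp C h (Comp C g f) = Comp C (Comp C h g) f)"

definition is_iso :: "('o, 'a, 'm) cat_scheme \<Rightarrow> 'a \<Rightarrow> bool" where
  "is_iso C f \<longleftrightarrow> f \<in> Arr C \<and>
     (\<exists>g \<in> Hom C (Cod C f) (Dom C f).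
        Comp C g f = Ide C (Dom C f) \<and> Comp C f g = Ide C (Cod C f))"

definition initial :: "('o, 'a, 'm) cat_scheme \<Rightarrow> 'o \<Rightarrow> bool" where
  "initial C z \<longleftrightarrow> z \<in> Ob C \<and> (\<forall>x\<in>Ob C. \<exists>!f. f \<in> Hom C z x)"

datatype ('j, 'b, 'o, 'a) functr =
  Functr (on_ob: "'j \<Rightarrow> 'o") (on_arr: "'b \<Rightarrow> 'a")

datatype ('j, 'b, 'o, 'a) nattrans =
  NatTrans (src: "('j, 'b, 'o, 'a) functr") (tgt: "('j, 'b, 'o, 'a) functr")
    (component: "'j \<Rightarrow> 'a")

text \<open>Object maps, arrow maps and components are extensional (\<^const>\<open>undefined\<close> off the index
  category), so that HOL equality of functors and of natural transformations is the intended one.\<close>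

definition functors ::
  "('j, 'b, 'k) cat_scheme \<Rightarrow> ('o, 'a, 'm) cat_scheme \<Rightarrow> ('j, 'b, 'o, 'a) functr set" where
  "functors J C = {F.
     on_ob F \<in> Ob J \<rightarrow>\<^sub>E Ob C \<and> on_arr F \<in> extensional (Arr J) \<and>
     (\<forall>f\<in>Arr J. on_arr F f \<in> Hom C (on_ob F (Dom J f)) (on_ob F (Cod J f))) \<and>
     (\<forall>j\<in>Ob J. on_arr F (Ide J j) = Ide C (on_ob F j)) \<and>
     (\<forall>f\<in>Arr J. \<forall>g\<in>Arr J. Cod J f = Dom J g \<longrightarrow>
        on_arr F (Comp J g f) = Comp C (on_arr F g) (on_arr F f))}"

definition nat_transformations ::
  "('j, 'b, 'k) cat_scheme \<Rightarrow> ('o, 'a, 'm) cat_scheme \<Rightarrow> ('j, 'b, 'o, 'a) nattrans set" where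
  "nat_transformations J C = {t.
     src t \<in> functors J C \<and> tgt t \<in> functors J C \<and> component t \<in> extensional (Ob J) \<and>
     (\<forall>j\<in>Ob J. component t j \<in> Hom C (on_ob (src t) j) (on_ob (tgt t) j)) \<and>
     (\<forall>f\<in>Arr J. Comp C (component t (Cod J f)) (on_arr (src t) f) =
                  Comp C (on_arr (tgt t) f) (component t (Dom J f)))}"

definition fun_cat ::
  "('j, 'b, 'k) cat_scheme \<Rightarrow> ('o, 'a, 'm) cat_scheme \<Rightarrow>
     (('j, 'b, 'o, 'a) functr, ('j, 'b, 'o, 'a) nattrans) cat" where
  "fun_cat J C = \<lparr>
     Ob = functors J C,
     Arr = nat_transformations J C,
     Dom = src,
     Cod = tgt,
     Ide = (\<lambda>F. NatTrans F F (\<lambda>j\<in>Ob J. Ide C (on_ob F j))),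
     Comp = (\<lambda>t s. NatTrans (src s) (tgt t) (\<lambda>j\<in>Ob J. Comp C (component t j) (component s j)))\<rparr>"

definition functor_comp ::
  "('j, 'b, 'n) cat_scheme \<Rightarrow> ('k, 'c, 'o, 'a) functr \<Rightarrow> ('j, 'b, 'k, 'c) functr \<Rightarrow>
     ('j, 'b, 'o, 'a) functr" where
  "functor_comp J G K =
     Functr (\<lambda>j\<in>Ob J. on_ob G (on_ob K j)) (\<lambda>f\<in>Arr J. on_arr G (on_arr K f))"

definition restrict_functor ::
  "('j, 'b, 'k) cat_scheme \<Rightarrow> ('j, 'b, 'o, 'a) functr \<Rightarrow> ('j, 'b, 'o, 'a) functr" where
  "restrict_functor J F = Functr (restrict (on_ob F) (Ob J)) (restrict (on_arr F) (Arr J))"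

definition restrict_nattrans ::
  "('j, 'b, 'k) cat_scheme \<Rightarrow> ('j, 'b, 'o, 'a) nattrans \<Rightarrow> ('j, 'b, 'o, 'a) nattrans" where
  "restrict_nattrans J t =
     NatTrans (restrict_functor J (src t)) (restrict_functor J (tgt t))
       (restrict (component t) (Ob J))"

definition cocone ::
  "('j, 'b, 'k) cat_scheme \<Rightarrow> ('o, 'a, 'm) cat_scheme \<Rightarrow> ('j, 'b, 'o, 'a) functr \<Rightarrow>
     'o \<Rightarrow> ('j \<Rightarrow> 'a) \<Rightarrow> bool" where
  "cocone J C D c \<iota> \<longleftrightarrow> c \<in> Ob C \<and>
     (\<forall>j\<in>Ob J. \<iota> j \<in> Hom C (on_ob D j) c) \<and>
     (\<forall>f\<in>Arr J. Comp C (\<iota> (Cod J f)) (on_arr D f) = \<iota> (Dom J f))"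

definition colimit ::
  "('j, 'b, 'k) cat_scheme \<Rightarrow> ('o, 'a, 'm) cat_scheme \<Rightarrow> ('j, 'b, 'o, 'a) functr \<Rightarrow>
     'o \<Rightarrow> ('j \<Rightarrow> 'a) \<Rightarrow> bool" where
  "colimit J C D c \<iota> \<longleftrightarrow> cocone J C D c \<iota> \<and>
     (\<forall>c' \<iota>'. cocone J C D c' \<iota>' \<longrightarrow>
        (\<exists>!u. u \<in> Hom C c c' \<and> (\<forall>j\<in>Ob J. Comp C u (\<iota> j) = \<iota>' j)))"

definition cone ::
  "('j, 'b, 'k) cat_scheme \<Rightarrow> ('o, 'a, 'm) cat_scheme \<Rightarrow> ('j, 'b, 'o, 'a) functr \<Rightarrow>
     'o \<Rightarrow> ('j \<Rightarrow> 'a) \<Rightarrow> bool" where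
  "cone J C D c \<pi> \<longleftrightarrow> c \<in> Ob C \<and>
     (\<forall>j\<in>Ob J. \<pi> j \<in> Hom C c (on_ob D j)) \<and>
     (\<forall>f\<in>Arr J. Comp C (on_arr D f) (\<pi> (Dom J f)) = \<pi> (Cod J f))"

definition limit ::
  "('j, 'b, 'k) cat_scheme \<Rightarrow> ('o, 'a, 'm) cat_scheme \<Rightarrow> ('j, 'b, 'o, 'a) functr \<Rightarrow>
     'o \<Rightarrow> ('j \<Rightarrow> 'a) \<Rightarrow> bool" where
  "limit J C D c \<pi> \<longleftrightarrow> cone J C D c \<pi> \<and>
     (\<forall>c' \<pi>'. cone J C D c' \<pi>' \<longrightarrow>
        (\<exists>!u. u \<in> Hom C c' c \<and> (\<forall>j\<in>Ob J. Comp C (\<pi> j) u = \<pi>' j)))"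

text \<open>The type \<open>'i\<close> plays the role of the universe of small sets: a small category is one whose
  objects and arrows are elements of \<open>'i\<close>.\<close>

definition bicomplete :: "'i itself \<Rightarrow> ('o, 'a, 'm) cat_scheme \<Rightarrow> bool" where
  "bicomplete U C \<longleftrightarrow>
     (\<forall>(J :: ('i, 'i) cat) D. category J \<longrightarrow> D \<in> functors J C \<longrightarrow>
        (\<exists>c \<pi>. limit J C D c \<pi>) \<and> (\<exists>c \<iota>. colimit J C D c \<iota>))"

definition left_kan_extension ::
  "('j, 'b, 'k) cat_scheme \<Rightarrow> ('j, 'b, 'l) cat_scheme \<Rightarrow> ('o, 'a, 'm) cat_scheme \<Rightarrow>
     ('j, 'b, 'o, 'a) functr \<Rightarrow> ('j, 'b, 'o, 'a) functr \<Rightarrow> ('j, 'b, 'o, 'a) nattrans \<Rightarrow> bool" where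
  \<comment> \<open>\<open>T\<close>, with unit \<open>\<eta>\<close>, is the left Kan extension of \<open>Q\<close> along the inclusion of \<open>I\<close> into \<open>J\<close>\<close>
  "left_kan_extension I J C Q T \<eta> \<longleftrightarrow>
     T \<in> functors J C \<and> \<eta> \<in> Hom (fun_cat I C) Q (restrict_functor I T) \<and>
     (\<forall>G\<in>functors J C. \<forall>\<alpha> \<in> Hom (fun_cat I C) Q (restrict_functor I G).
        \<exists>!\<beta>. \<beta> \<in> Hom (fun_cat J C) T G \<and> Comp (fun_cat I C) (restrict_nattrans I \<beta>) \<eta> = \<alpha>)"


section \<open>Posets as categories; cubes\<close>

text \<open>A poset is given by its order relation \<open>r\<close>, its underlying set being \<open>Field r\<close>.\<close>

definition poset_cat :: "'i rel \<Rightarrow> ('i, 'i \<times> 'i) cat" where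
  "poset_cat r = \<lparr>Ob = Field r, Arr = r, Dom = fst, Cod = snd,
     Ide = (\<lambda>x. (x, x)), Comp = (\<lambda>g f. (fst f, snd g))\<rparr>"

definition subposet_cat :: "'p::order set \<Rightarrow> ('p, 'p \<times> 'p) cat" where
  "subposet_cat A = poset_cat {(x, y). x \<in> A \<and> y \<in> A \<and> x \<le> y}"

type_synonym ('o, 'a) cube = "(nat set, nat set \<times> nat set, 'o, 'a) functr"

text \<open>\<open>cubes n C\<close> is the set of \<open>(n+1)\<close>-cubes in \<open>C\<close>.\<close>

definition cubes :: "nat \<Rightarrow> ('o, 'a, 'm) cat_scheme \<Rightarrow> ('o, 'a) cube set" where
  "cubes n C = functors (subposet_cat (Pow {0..n})) C"

text \<open>For \<open>A \<subseteq> B \<subseteq> {0..n}\<close>, the face of \<open>X\<close> with initial vertex \<open>A\<close> and final vertex \<open>B\<close> is the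
  restriction of \<open>X\<close> to the interval \<open>{S. A \<subseteq> S \<and> S \<subseteq> B}\<close>; its dimension is \<open>card (B - A)\<close>.
  The cube itself is the face with \<open>A = {}\<close> and \<open>B = {0..n}\<close>.\<close>

definition cocartesian_face ::
  "('o, 'a, 'm) cat_scheme \<Rightarrow> ('o, 'a) cube \<Rightarrow> nat set \<Rightarrow> nat set \<Rightarrow> bool" where
  "cocartesian_face C X A B \<longleftrightarrow>
     (let J = subposet_cat {S. A \<subseteq> S \<and> S \<subset> B} in
      \<exists>c \<iota> u. colimit J C (restrict_functor J X) c \<iota> \<and>
        u \<in> Hom C c (on_ob X B) \<and> (\<forall>S\<in>Ob J. Comp C u (\<iota> S) = on_arr X (S, B)) \<and> is_iso C u)"

definition cartesian_face ::
  "('o, 'a, 'm) cat_scheme \<Rightarrow> ('o, 'a) cube \<Rightarrow> nat set \<Rightarrow> nat set \<Rightarrow> bool" where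
  "cartesian_face C X A B \<longleftrightarrow>
     (let J = subposet_cat {S. A \<subset> S \<and> S \<subseteq> B} in
      \<exists>c \<pi> u. limit J C (restrict_functor J X) c \<pi> \<and>
        u \<in> Hom C (on_ob X A) c \<and> (\<forall>S\<in>Ob J. Comp C (\<pi> S) u = on_arr X (A, S)) \<and> is_iso C u)"

definition strongly_bicartesian ::
  "('o, 'a, 'm) cat_scheme \<Rightarrow> nat \<Rightarrow> ('o, 'a) cube \<Rightarrow> bool" where
  "strongly_bicartesian C n X \<longleftrightarrow> X \<in> cubes n C \<and>
     (\<forall>A B. A \<subseteq> B \<longrightarrow> B \<subseteq> {0..n} \<longrightarrow> card (B - A) \<ge> 2 \<longrightarrow>
        cartesian_face C X A B \<and> cocartesian_face C X A B)"


section \<open>Model categories\<close>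

record ('o, 'a) model_cat = "('o, 'a) cat" +
  Weq :: "'a set"
  Cof :: "'a set"
  Fib :: "'a set"

definition has_lifts :: "('o, 'a, 'm) cat_scheme \<Rightarrow> 'a \<Rightarrow> 'a \<Rightarrow> bool" where
  "has_lifts C i p \<longleftrightarrow>
     (\<forall>f \<in> Hom C (Dom C i) (Dom C p). \<forall>g \<in> Hom C (Cod C i) (Cod C p).
        Comp C p f = Comp C g i \<longrightarrow>
        (\<exists>h \<in> Hom C (Cod C i) (Dom C p). Comp C h i = f \<and> Comp C p h = g))"

definition retract_of :: "('o, 'a, 'm) cat_scheme \<Rightarrow> 'a \<Rightarrow> 'a \<Rightarrow> bool" where
  "retract_of C f g \<longleftrightarrow> f \<in> Arr C \<and> g \<in> Arr C \<and>
     (\<exists>i \<in> Hom C (Dom C f) (Dom C g). \<exists>r \<in> Hom C (Dom C g) (Dom C f).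
      \<exists>j \<in> Hom C (Cod C f) (Cod C g). \<exists>s \<in> Hom C (Cod C g) (Cod C f).
        Comp C r i = Ide C (Dom C f) \<and> Comp C s j = Ide C (Cod C f) \<and>
        Comp C g i = Comp C j f \<and> Comp C f r = Comp C s g)"

definition closed_under_retracts :: "('o, 'a, 'm) cat_scheme \<Rightarrow> 'a set \<Rightarrow> bool" where
  "closed_under_retracts C S \<longleftrightarrow> (\<forall>f g. retract_of C f g \<longrightarrow> g \<in> S \<longrightarrow> f \<in> S)"

definition two_of_three :: "('o, 'a, 'm) cat_scheme \<Rightarrow> 'a set \<Rightarrow> bool" where
  "two_of_three C W \<longleftrightarrow>
     (\<forall>f\<in>Arr C. \<forall>g\<in>Arr C. Cod C f = Dom C g \<longrightarrow>
        (f \<in> W \<and> g \<in> W \<longrightarrow> Comp C g f \<in> W) \<and>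
        (f \<in> W \<and> Comp C g f \<in> W \<longrightarrow> g \<in> W) \<and>
        (g \<in> W \<and> Comp C g f \<in> W \<longrightarrow> f \<in> W))"

definition factorizes :: "('o, 'a, 'm) cat_scheme \<Rightarrow> 'a set \<Rightarrow> 'a set \<Rightarrow> bool" where
  "factorizes C L R \<longleftrightarrow>
     (\<forall>f\<in>Arr C. \<exists>i\<in>L. \<exists>p\<in>R. Cod C i = Dom C p \<and> Comp C p i = f)"

definition model_category :: "'i itself \<Rightarrow> ('o, 'a, 'm) model_cat_scheme \<Rightarrow> bool" where
  "model_category U M \<longleftrightarrow> category M \<and> bicomplete U M \<and>
     Weq M \<subseteq> Arr M \<and> Cof M \<subseteq> Arr M \<and> Fib M \<subseteq> Arr M \<and>
     two_of_three M (Weq M) \<and>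
     closed_under_retracts M (Weq M) \<and> closed_under_retracts M (Cof M) \<and>
     closed_under_retracts M (Fib M) \<and>
     (\<forall>i \<in> Cof M \<inter> Weq M. \<forall>p \<in> Fib M. has_lifts M i p) \<and>
     (\<forall>i \<in> Cof M. \<forall>p \<in> Fib M \<inter> Weq M. has_lifts M i p) \<and>
     factorizes M (Cof M) (Fib M \<inter> Weq M) \<and> factorizes M (Cof M \<inter> Weq M) (Fib M)"

text \<open>The functor category with the classes of maps of the projective model structure; that these
  satisfy the model category axioms is a property of \<open>J\<close> and \<open>M\<close>.\<close>

definition projective ::
  "('j, 'b, 'k) cat_scheme \<Rightarrow> ('o, 'a, 'm) model_cat_scheme \<Rightarrow>
     (('j, 'b, 'o, 'a) functr, ('j, 'b, 'o, 'a) nattrans) model_cat" where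
  "projective J M =
     (let N = fun_cat J M;
          W = {t \<in> Arr N. \<forall>j\<in>Ob J. component t j \<in> Weq M};
          R = {t \<in> Arr N. \<forall>j\<in>Ob J. component t j \<in> Fib M}
      in \<lparr>Ob = Ob N, Arr = Arr N, Dom = Dom N, Cod = Cod N, Ide = Ide N, Comp = Comp N,
          Weq = W, Cof = {t \<in> Arr N. \<forall>p \<in> R \<inter> W. has_lifts N t p}, Fib = R\<rparr>)"

definition good_model_category :: "'i itself \<Rightarrow> ('o, 'a, 'm) model_cat_scheme \<Rightarrow> bool" where
  "good_model_category U M \<longleftrightarrow> model_category U M \<and>
     (\<forall>r :: 'i rel. Partial_order r \<longrightarrow> model_category U (projective (poset_cat r) M))"

definition cofibrant :: "('o, 'a, 'm) model_cat_scheme \<Rightarrow> 'o \<Rightarrow> bool" where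
  "cofibrant M x \<longleftrightarrow> x \<in> Ob M \<and> (\<exists>z. initial M z \<and> (\<exists>f \<in> Hom M z x. f \<in> Cof M))"

definition cofibrant_replacement ::
  "('o, 'a, 'm) model_cat_scheme \<Rightarrow> 'o \<Rightarrow> 'o \<Rightarrow> 'a \<Rightarrow> bool" where
  "cofibrant_replacement M x y q \<longleftrightarrow> cofibrant M y \<and> q \<in> Hom M y x \<and> q \<in> Weq M"

text \<open>The homotopy colimit of a diagram is the colimit of a projectively cofibrant replacement.
  Such replacements exist when the model category is good, and whether the comparison map is a weak
  equivalence does not depend on the one chosen, so we may quantify over all of them.\<close>

definition homotopy_cocartesian ::
  "('o, 'a, 'm) model_cat_scheme \<Rightarrow> nat \<Rightarrow> ('o, 'a) cube \<Rightarrow> bool" where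
  "homotopy_cocartesian M n X \<longleftrightarrow>
     (let J = subposet_cat {S. S \<subset> {0..n}} in
      \<forall>Q q c \<iota> u.
        cofibrant_replacement (projective J M) (restrict_functor J X) Q q \<longrightarrow>
        colimit J M Q c \<iota> \<longrightarrow>
        u \<in> Hom M c (on_ob X {0..n}) \<longrightarrow>
        (\<forall>S\<in>Ob J. Comp M u (\<iota> S) = Comp M (on_arr X (S, {0..n})) (component q S)) \<longrightarrow>
        u \<in> Weq M)"


section \<open>Codegree, join-dimension and the codegree approximation\<close>

text \<open>A poset \<open>P\<close> is here a whole type \<open>'p\<close> of class \<^class>\<open>order\<close>, as a category
  \<open>subposet_cat UNIV\<close>.\<close>

definition codegree ::
  "('o, 'a, 'm) model_cat_scheme \<Rightarrow> nat \<Rightarrow> ('p::lattice, 'p \<times> 'p, 'o, 'a) functr \<Rightarrow> bool" where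
  "codegree M n F \<longleftrightarrow>
     (\<forall>X. strongly_bicartesian (subposet_cat (UNIV :: 'p set)) n X \<longrightarrow>
        homotopy_cocartesian M n (functor_comp (subposet_cat (Pow {0..n})) F X))"

definition minimal :: "'p::order \<Rightarrow> bool" where
  "minimal v \<longleftrightarrow> (\<nexists>x. x < v)"

definition join_irreducible :: "'p::lattice \<Rightarrow> bool" where
  "join_irreducible v \<longleftrightarrow> (\<nexists>x y. x < v \<and> y < v \<and> v = sup x y)"

definition join_decomposition :: "'p::lattice \<Rightarrow> nat \<Rightarrow> (nat \<Rightarrow> 'p) \<Rightarrow> bool" where
  "join_decomposition v k p \<longleftrightarrow> k \<ge> 1 \<and> v = Sup_fin (p ` {..<k})"

definition reduced :: "'p::lattice \<Rightarrow> nat \<Rightarrow> (nat \<Rightarrow> 'p) \<Rightarrow> bool" where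
  "reduced v k p \<longleftrightarrow>
     (if k = 1 then \<not> minimal v else \<forall>i<k. Sup_fin (p ` ({..<k} - {i})) \<noteq> v)"

definition indecomposable :: "nat \<Rightarrow> (nat \<Rightarrow> 'p::lattice) \<Rightarrow> bool" where
  "indecomposable k p \<longleftrightarrow> (\<forall>i<k. join_irreducible (p i))"

definition has_jdim :: "'p::lattice \<Rightarrow> nat \<Rightarrow> bool" where
  "has_jdim v k \<longleftrightarrow> (\<exists>p. join_decomposition v k p \<and> reduced v k p \<and> indecomposable k p)"

text \<open>The \<open>THE\<close> is justified by uniqueness of reduced indecomposable join-decompositions in a
  distributive lattice.\<close>

definition jdim :: "'p::distrib_lattice \<Rightarrow> enat" where
  "jdim v = (if minimal v then 0 else if \<exists>k. has_jdim v k then enat (THE k. has_jdim v k) else \<infinity>)"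

definition jdim_le :: "nat \<Rightarrow> 'p::distrib_lattice set" where
  "jdim_le k = {v. jdim v \<le> enat k}"

text \<open>HOL cannot quantify over types inside a definition, so the type carrying the
  auxiliary lattice \<open>Q\<close> is a parameter; leaving it a free type variable in a hypothesis amounts to
  the existential quantification over \<open>Q\<close>.\<close>

definition join_factorization_lattice ::
  "'p::distrib_lattice itself \<Rightarrow> 'q::distrib_lattice itself \<Rightarrow> bool" where
  "join_factorization_lattice P Q \<longleftrightarrow>
     (\<exists>v :: 'p. minimal v) \<and>
     (\<forall>A :: 'q set. A \<noteq> {} \<longrightarrow> (\<exists>m\<in>A. \<forall>y\<in>A. \<not> y < m)) \<and>
     (\<exists>f :: 'p \<Rightarrow> 'q. mono f \<and> (\<forall>v. jdim (f v) = jdim v))"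

text \<open>\<open>T\<close> is a model of \<open>T\<^sub>k F\<close>, the homotopy left Kan extension, and \<open>\<epsilon>\<close> the canonical
  map \<open>T\<^sub>k F \<rightarrow> F\<close>.\<close>

definition codegree_approximation ::
  "('o, 'a, 'm) model_cat_scheme \<Rightarrow> nat \<Rightarrow> ('p::distrib_lattice, 'p \<times> 'p, 'o, 'a) functr \<Rightarrow>
     ('p, 'p \<times> 'p, 'o, 'a) functr \<Rightarrow> ('p, 'p \<times> 'p, 'o, 'a) nattrans \<Rightarrow> bool" where
  "codegree_approximation M k F T \<epsilon> \<longleftrightarrow>
     (let I = subposet_cat (jdim_le k :: 'p set); J = subposet_cat (UNIV :: 'p set) in
      \<exists>Q q \<eta>. cofibrant_replacement (projective I M) (restrict_functor I F) Q q \<and>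
        left_kan_extension I J M Q T \<eta> \<and>
        \<epsilon> \<in> Hom (fun_cat J M) T F \<and>
        Comp (fun_cat I M) (restrict_nattrans I \<epsilon>) \<eta> = q)"

definition objectwise_weak_equivalence ::
  "('j, 'b, 'k) cat_scheme \<Rightarrow> ('o, 'a, 'm) model_cat_scheme \<Rightarrow> ('j, 'b, 'o, 'a) nattrans \<Rightarrow> bool" where
  "objectwise_weak_equivalence J M t \<longleftrightarrow> (\<forall>j\<in>Ob J. component t j \<in> Weq M)"

end

(* Suppose eps is not an equivalence at v, chosen with f v minimal. Then jdim v > n, and omitting
   one factor at a time from the indecomposable decomposition of v gives x 0, ..., x n < v with
   pairwise joins v; the meets of the x i form a strongly bicartesian (n+1)-cube X with final
   vertex v. Since X S <= x i for some i and f (x i) < f v, eps is an equivalence at all the other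
   vertices. Every u <= v with jdim u <= n lies below some x i, and for such u there is a least S
   with u <= X S. Hence T o X on the punctured cube is itself a left Kan extension of a
   projectively cofibrant diagram, so it is projectively cofibrant, and its colimit is T v. It is
   therefore a cofibrant replacement of the punctured cube F o X, and the codegree hypothesis
   applied to it says that eps at v is an equivalence. *)

theory Submission
  imports Defs
begin

section \<open>Categories and functors on posets\<close>

text \<open>\<open>T\<close> is known only through its universal property among functors on all of
  \<open>P\<close>, while the argument needs it on down-closed subsets: the elements below
  \<open>v\<close>, and those below some \<open>x i\<close>. A functor on a down-closed set extends
  to \<open>P\<close> by the terminal object of \<open>M\<close>, which is its right Kan extension,
  so maps out of a restriction of \<open>T\<close> become maps out of \<open>T\<close>; no pointwise
  colimit formula enters. The same extension preserves trivial fibrations, because the identity of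
  the terminal object is one. Lifting problems for the restricted diagram thus become lifting
  problems for the cofibrant \<open>Q\<close>. The descent runs in the auxiliary lattice because the
  chain condition lives there. A monotone \<open>f\<close> gives only
  \<open>f (x i) \<le> f v\<close>; strictness comes from the join-dimension, which \<open>f\<close>
  preserves and which drops when a factor is omitted.\<close>

lemma
  assumes "category C"
  shows category_comp: "f \<in> Hom C x y \<Longrightarrow> g \<in> Hom C y z \<Longrightarrow> Comp C g f \<in> Hom C x z"
    and category_assoc: "f \<in> Hom C w x \<Longrightarrow> g \<in> Hom C x y \<Longrightarrow> h \<in> Hom C y z \<Longrightarrow>
      Comp C (Comp C h g) f = Comp C h (Comp C g f)"
    and category_id: "x \<in> Ob C \<Longrightarrow> Ide C x \<in> Hom C x x"
    and category_id_right: "f \<in> Hom C x y \<Longrightarrow> Comp C f (Ide C x) = f"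
    and category_id_left: "f \<in> Hom C x y \<Longrightarrow> Comp C (Ide C y) f = f"
    and category_dom: "f \<in> Hom C x y \<Longrightarrow> x \<in> Ob C"
    and category_cod: "f \<in> Hom C x y \<Longrightarrow> y \<in> Ob C"
  using assms unfolding category_def Hom_def by auto

lemma Field_subposet [simp]: "Field {(x, y). x \<in> A \<and> y \<in> A \<and> x \<le> y} = (A :: 'p::order set)"
  by (auto simp: Field_def)

lemma subposet_cat_simps [simp]:
  "Ob (subposet_cat A) = A"
  "Arr (subposet_cat A) = {(x, y). x \<in> A \<and> y \<in> A \<and> x \<le> y}"
  "Dom (subposet_cat A) = fst" "Cod (subposet_cat A) = snd"
  "Ide (subposet_cat A) x = (x, x)" "Comp (subposet_cat A) a b = (fst b, snd a)"
  for A :: "'p::order set"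
  by (simp_all add: subposet_cat_def poset_cat_def)

lemma Hom_subposet [simp]:
  "a \<in> Hom (subposet_cat A) x y \<longleftrightarrow> a = (x, y) \<and> x \<in> A \<and> y \<in> A \<and> x \<le> y"
  by (auto simp: Hom_def)

text \<open>Naturality of a bare family of components over \<open>A\<close>, where \<open>F\<close>
  and \<open>G\<close> may live on larger posets. Passing to a subset then needs neither restricted
  functors nor extensional components.\<close>

definition natural_on :: "('o, 'a, 'm) cat_scheme \<Rightarrow> 'p::order set \<Rightarrow> ('p, 'p \<times> 'p, 'o, 'a) functr \<Rightarrow>
    ('p, 'p \<times> 'p, 'o, 'a) functr \<Rightarrow> ('p \<Rightarrow> 'a) \<Rightarrow> bool" where
  "natural_on C A F G \<alpha> \<longleftrightarrow>
    (\<forall>x\<in>A. \<alpha> x \<in> Hom C (on_ob F x) (on_ob G x)) \<and>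
    (\<forall>x\<in>A. \<forall>y\<in>A. x \<le> y \<longrightarrow> Comp C (\<alpha> y) (on_arr F (x, y)) = Comp C (on_arr G (x, y)) (\<alpha> x))"

lemma natural_onI:
  assumes "\<And>x. x \<in> A \<Longrightarrow> \<alpha> x \<in> Hom C (on_ob F x) (on_ob G x)"
    and "\<And>x y. x \<in> A \<Longrightarrow> y \<in> A \<Longrightarrow> x \<le> y \<Longrightarrow>
      Comp C (\<alpha> y) (on_arr F (x, y)) = Comp C (on_arr G (x, y)) (\<alpha> x)"
  shows "natural_on C A F G \<alpha>"
  using assms by (auto simp: natural_on_def)

lemma natural_on_hom: "natural_on C A F G \<alpha> \<Longrightarrow> x \<in> A \<Longrightarrow> \<alpha> x \<in> Hom C (on_ob F x) (on_ob G x)"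
  and natural_on_eq: "natural_on C A F G \<alpha> \<Longrightarrow> x \<in> A \<Longrightarrow> y \<in> A \<Longrightarrow> x \<le> y \<Longrightarrow>
      Comp C (\<alpha> y) (on_arr F (x, y)) = Comp C (on_arr G (x, y)) (\<alpha> x)"
  by (auto simp: natural_on_def)

lemma natural_on_subset: "natural_on C A F G \<alpha> \<Longrightarrow> B \<subseteq> A \<Longrightarrow> natural_on C B F G \<alpha>"
  by (auto simp: natural_on_def)

lemma natural_on_cong:
  assumes "\<And>x. x \<in> A \<Longrightarrow> on_ob F x = on_ob F' x" "\<And>x. x \<in> A \<Longrightarrow> on_ob G x = on_ob G' x"
    and "\<And>x y. x \<in> A \<Longrightarrow> y \<in> A \<Longrightarrow> x \<le> y \<Longrightarrow> on_arr F (x, y) = on_arr F' (x, y)"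
    and "\<And>x y. x \<in> A \<Longrightarrow> y \<in> A \<Longrightarrow> x \<le> y \<Longrightarrow> on_arr G (x, y) = on_arr G' (x, y)"
    and "\<And>x. x \<in> A \<Longrightarrow> \<alpha> x = \<alpha>' x"
  shows "natural_on C A F G \<alpha> \<longleftrightarrow> natural_on C A F' G' \<alpha>'"
  using assms by (simp add: natural_on_def)

lemma functors_subposet_iff:
  "F \<in> functors (subposet_cat A) C \<longleftrightarrow>
    on_ob F \<in> extensional A \<and> on_arr F \<in> extensional {(x, y). x \<in> A \<and> y \<in> A \<and> x \<le> y} \<and>
    (\<forall>x\<in>A. on_ob F x \<in> Ob C \<and> on_arr F (x, x) = Ide C (on_ob F x)) \<and>
    (\<forall>x\<in>A. \<forall>y\<in>A. x \<le> y \<longrightarrow> on_arr F (x, y) \<in> Hom C (on_ob F x) (on_ob F y)) \<and>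
    (\<forall>x\<in>A. \<forall>y\<in>A. \<forall>z\<in>A. x \<le> y \<longrightarrow> y \<le> z \<longrightarrow>
      Comp C (on_arr F (y, z)) (on_arr F (x, y)) = on_arr F (x, z))"
proof -
  have "(\<forall>f\<in>{(x, y). x \<in> A \<and> y \<in> A \<and> x \<le> y}. \<forall>g\<in>{(x, y). x \<in> A \<and> y \<in> A \<and> x \<le> y}.
      snd f = fst g \<longrightarrow> on_arr F (fst f, snd g) = Comp C (on_arr F g) (on_arr F f)) \<longleftrightarrow>
    (\<forall>x\<in>A. \<forall>y\<in>A. \<forall>z\<in>A. x \<le> y \<longrightarrow> y \<le> z \<longrightarrow>
      Comp C (on_arr F (y, z)) (on_arr F (x, y)) = on_arr F (x, z))"
    by (fastforce simp del: split_paired_All)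
  then show ?thesis
    by (auto simp: functors_def PiE_def Pi_def)
qed

lemma
  assumes "F \<in> functors (subposet_cat A) C"
  shows functor_ob: "x \<in> A \<Longrightarrow> on_ob F x \<in> Ob C"
    and functor_id: "x \<in> A \<Longrightarrow> on_arr F (x, x) = Ide C (on_ob F x)"
    and functor_arr: "x \<in> A \<Longrightarrow> y \<in> A \<Longrightarrow> x \<le> y \<Longrightarrow> on_arr F (x, y) \<in> Hom C (on_ob F x) (on_ob F y)"
    and functor_Comp: "x \<in> A \<Longrightarrow> y \<in> A \<Longrightarrow> z \<in> A \<Longrightarrow> x \<le> y \<Longrightarrow> y \<le> z \<Longrightarrow>
      Comp C (on_arr F (y, z)) (on_arr F (x, y)) = on_arr F (x, z)"
  using assms by (simp_all add: functors_subposet_iff)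

lemma Hom_fun_cat_iff:
  "t \<in> Hom (fun_cat (subposet_cat A) C) F G \<longleftrightarrow>
    src t = F \<and> tgt t = G \<and> F \<in> functors (subposet_cat A) C \<and> G \<in> functors (subposet_cat A) C \<and>
    component t \<in> extensional A \<and> natural_on C A F G (component t)"
  unfolding Hom_def fun_cat_def nat_transformations_def natural_on_def by auto

lemma Hom_fun_cat_eqI:
  assumes "s \<in> Hom (fun_cat (subposet_cat A) C) F G" "t \<in> Hom (fun_cat (subposet_cat A) C) F G"
    and "\<And>x. x \<in> A \<Longrightarrow> component s x = component t x"
  shows "s = t"
proof -
  have "component s = component t"
    using assms unfolding Hom_fun_cat_iff by (intro extensionalityI[of _ A]) auto
  then show ?thesis
    using assms(1,2) unfolding Hom_fun_cat_iff by (cases s; cases t) simp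
qed

lemma Hom_fun_catI:
  assumes "F \<in> functors (subposet_cat A) C" "G \<in> functors (subposet_cat A) C" "natural_on C A F G \<alpha>"
  shows "NatTrans F G (restrict \<alpha> A) \<in> Hom (fun_cat (subposet_cat A) C) F G"
proof -
  have "natural_on C A F G (restrict \<alpha> A)"
    using assms(3) natural_on_cong[of A F F G G \<alpha> "restrict \<alpha> A" C] by simp
  then show ?thesis using assms by (simp add: Hom_fun_cat_iff)
qed

lemma component_Comp_fun_cat:
  "x \<in> A \<Longrightarrow> component (Comp (fun_cat (subposet_cat A) C) t s) x = Comp C (component t x) (component s x)"
  by (simp add: fun_cat_def)

lemma natural_on_comp:
  assumes "category C" "natural_on C A F G \<alpha>" "natural_on C A G H \<beta>"
    and "F \<in> functors (subposet_cat A1) C" "G \<in> functors (subposet_cat A2) C"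
    "H \<in> functors (subposet_cat A3) C" and "A \<subseteq> A1" "A \<subseteq> A2" "A \<subseteq> A3"
  shows "natural_on C A F H (\<lambda>x. Comp C (\<beta> x) (\<alpha> x))"
proof (rule natural_onI)
  fix x assume "x \<in> A"
  then show "Comp C (\<beta> x) (\<alpha> x) \<in> Hom C (on_ob F x) (on_ob H x)"
    by (auto intro: category_comp[OF assms(1) natural_on_hom[OF assms(2)] natural_on_hom[OF assms(3)]])
next
  fix x y assume xy: "x \<in> A" "y \<in> A" "x \<le> y"
  have f: "on_arr F (x, y) \<in> Hom C (on_ob F x) (on_ob F y)"
    "on_arr G (x, y) \<in> Hom C (on_ob G x) (on_ob G y)"
    "on_arr H (x, y) \<in> Hom C (on_ob H x) (on_ob H y)"
    using assms xy by (auto intro!: functor_arr)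
  note h = natural_on_hom[OF assms(2)] natural_on_hom[OF assms(3)]
  note a = category_assoc[OF assms(1)]
  show "Comp C (Comp C (\<beta> y) (\<alpha> y)) (on_arr F (x, y)) = Comp C (on_arr H (x, y)) (Comp C (\<beta> x) (\<alpha> x))"
    using a[OF f(1) h(1)[OF xy(2)] h(2)[OF xy(2)]] a[OF h(1)[OF xy(1)] f(2) h(2)[OF xy(2)]]
      a[OF h(1)[OF xy(1)] h(2)[OF xy(1)] f(3)]
      natural_on_eq[OF assms(2) xy] natural_on_eq[OF assms(3) xy] by simp
qed

lemma fun_cat_comp:
  assumes "category C" "s \<in> Hom (fun_cat (subposet_cat A) C) F G"
    "t \<in> Hom (fun_cat (subposet_cat A) C) G H"
  shows "Comp (fun_cat (subposet_cat A) C) t s \<in> Hom (fun_cat (subposet_cat A) C) F H"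
proof -
  have f: "F \<in> functors (subposet_cat A) C" "G \<in> functors (subposet_cat A) C"
       "H \<in> functors (subposet_cat A) C" "src s = F" "tgt t = H"
    and n: "natural_on C A F G (component s)" "natural_on C A G H (component t)"
    using assms by (auto simp: Hom_fun_cat_iff)
  from Hom_fun_catI[OF f(1,3) natural_on_comp[OF assms(1) n f(1-3)]] show ?thesis
    using f by (simp add: fun_cat_def)
qed

lemma restrict_functor_subposet:
  assumes "F \<in> functors (subposet_cat A) C" "B \<subseteq> A"
  shows "restrict_functor (subposet_cat B) F \<in> functors (subposet_cat B) C"
  using assms unfolding functors_subposet_iff by (auto simp: restrict_functor_def subset_iff)

lemma restrict_functor_simps [simp]:
  "x \<in> B \<Longrightarrow> on_ob (restrict_functor (subposet_cat B) F) x = on_ob F x"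
  "x \<in> B \<Longrightarrow> y \<in> B \<Longrightarrow> x \<le> y \<Longrightarrow> on_arr (restrict_functor (subposet_cat B) F) (x, y) = on_arr F (x, y)"
  by (simp_all add: restrict_functor_def)

lemma natural_on_restrict_functor [simp]:
  "natural_on C B F (restrict_functor (subposet_cat B) G) \<alpha> \<longleftrightarrow> natural_on C B F G \<alpha>"
  "natural_on C B (restrict_functor (subposet_cat B) F) G \<alpha> \<longleftrightarrow> natural_on C B F G \<alpha>"
  by (simp_all add: natural_on_def)

lemma component_restrict_nattrans [simp]:
  "x \<in> B \<Longrightarrow> component (restrict_nattrans (subposet_cat B) t) x = component t x"
  by (simp add: restrict_nattrans_def)

lemma restrict_nattrans_Hom:
  assumes "t \<in> Hom (fun_cat (subposet_cat A) C) F G" "B \<subseteq> A"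
  shows "restrict_nattrans (subposet_cat B) t \<in> Hom (fun_cat (subposet_cat B) C)
    (restrict_functor (subposet_cat B) F) (restrict_functor (subposet_cat B) G)"
proof -
  have "natural_on C B (restrict_functor (subposet_cat B) F) (restrict_functor (subposet_cat B) G)
      (component t)"
    using assms unfolding Hom_fun_cat_iff natural_on_def by (auto simp: subset_iff)
  then show ?thesis
    using assms Hom_fun_catI[OF restrict_functor_subposet restrict_functor_subposet, of F A C B G A "component t"]
    by (simp add: restrict_nattrans_def Hom_fun_cat_iff[of t])
qed

text \<open>Extensional by construction, so that only the functor laws on \<open>A\<close> remain to
  be checked.\<close>

definition poset_functor :: "'p::order set \<Rightarrow> ('p \<Rightarrow> 'o) \<Rightarrow> ('p \<Rightarrow> 'p \<Rightarrow> 'a) \<Rightarrow>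
    ('p, 'p \<times> 'p, 'o, 'a) functr" where
  "poset_functor A f h =
    Functr (restrict f A) (\<lambda>(x, y)\<in>{(x, y). x \<in> A \<and> y \<in> A \<and> x \<le> y}. h x y)"

lemma poset_functor_simps [simp]:
  "x \<in> A \<Longrightarrow> on_ob (poset_functor A f h) x = f x"
  "x \<in> A \<Longrightarrow> y \<in> A \<Longrightarrow> x \<le> y \<Longrightarrow> on_arr (poset_functor A f h) (x, y) = h x y"
  by (simp_all add: poset_functor_def)

lemma poset_functor_functors:
  assumes "\<And>x. x \<in> A \<Longrightarrow> f x \<in> Ob C" "\<And>x. x \<in> A \<Longrightarrow> h x x = Ide C (f x)"
    and "\<And>x y. x \<in> A \<Longrightarrow> y \<in> A \<Longrightarrow> x \<le> y \<Longrightarrow> h x y \<in> Hom C (f x) (f y)"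
    and "\<And>x y z. x \<in> A \<Longrightarrow> y \<in> A \<Longrightarrow> z \<in> A \<Longrightarrow> x \<le> y \<Longrightarrow> y \<le> z \<Longrightarrow> Comp C (h y z) (h x y) = h x z"
  shows "poset_functor A f h \<in> functors (subposet_cat A) C"
proof -
  have "on_ob (poset_functor A f h) \<in> extensional A"
    "on_arr (poset_functor A f h) \<in> extensional {(x, y). x \<in> A \<and> y \<in> A \<and> x \<le> y}"
    by (simp_all add: poset_functor_def)
  then show ?thesis
    unfolding functors_subposet_iff using assms by (auto intro: order_trans)
qed

lemma const_functor:
  assumes "category C" "c \<in> Ob C"
  shows "poset_functor A (\<lambda>_. c) (\<lambda>_ _. Ide C c) \<in> functors (subposet_cat A) C"
  using category_id[OF assms] assms
  by (intro poset_functor_functors) (auto simp: category_id_right[OF assms(1) category_id[OF assms]])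

text \<open>Transformations into a constant functor are cocones, so statements about
  \<open>natural_on\<close> cover colimits as well.\<close>

lemma natural_on_const:
  assumes "category C" "F \<in> functors (subposet_cat B) C" "A \<subseteq> B" "A \<subseteq> D" "c \<in> Ob C"
  shows "natural_on C A F (poset_functor D (\<lambda>_. c) (\<lambda>_ _. Ide C c)) \<iota> \<longleftrightarrow>
    (\<forall>x\<in>A. \<iota> x \<in> Hom C (on_ob F x) c) \<and>
    (\<forall>x\<in>A. \<forall>y\<in>A. x \<le> y \<longrightarrow> Comp C (\<iota> y) (on_arr F (x, y)) = \<iota> x)"
  unfolding natural_on_def using assms(4)
  by (auto simp: subset_iff category_id_left[OF assms(1)])

lemma pullback_functor:
  assumes "F \<in> functors (subposet_cat B) C" "g ` A \<subseteq> B" "mono_on A g"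
  shows "poset_functor A (\<lambda>x. on_ob F (g x)) (\<lambda>x y. on_arr F (g x, g y)) \<in> functors (subposet_cat A) C"
proof -
  have g: "g x \<in> B" if "x \<in> A" for x
    using assms that by auto
  have m: "g x \<le> g y" if "x \<in> A" "y \<in> A" "x \<le> y" for x y
    using assms(3) that by (auto simp: mono_on_def)
  show ?thesis
    by (rule poset_functor_functors)
      (auto simp: g m functor_ob[OF assms(1)] functor_id[OF assms(1)] functor_arr[OF assms(1)]
        functor_Comp[OF assms(1)])
qed

section \<open>Kan extension from a subposet\<close>

definition terminal :: "('o, 'a, 'm) cat_scheme \<Rightarrow> 'o \<Rightarrow> bool" where
  "terminal C t \<longleftrightarrow> t \<in> Ob C \<and> (\<forall>x\<in>Ob C. \<exists>!f. f \<in> Hom C x t)"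

definition to_terminal :: "('o, 'a, 'm) cat_scheme \<Rightarrow> 'o \<Rightarrow> 'o \<Rightarrow> 'a" where
  "to_terminal C t x = (THE f. f \<in> Hom C x t)"

lemma
  assumes "terminal C t"
  shows to_terminal_Hom: "x \<in> Ob C \<Longrightarrow> to_terminal C t x \<in> Hom C x t"
    and terminal_unique: "x \<in> Ob C \<Longrightarrow> f \<in> Hom C x t \<Longrightarrow> g \<in> Hom C x t \<Longrightarrow> f = g"
    and terminal_Ob: "t \<in> Ob C"
proof -
  show "to_terminal C t x \<in> Hom C x t" if "x \<in> Ob C"
    using assms theI'[of "\<lambda>f. f \<in> Hom C x t"] that by (simp add: terminal_def to_terminal_def)
qed (use assms in \<open>auto simp: terminal_def\<close>)

text \<open>For a down-closed set \<open>D\<close> this is the right Kan extension of \<open>G\<close> along the inclusion of \<open>D\<close>.\<close>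

definition terminal_extension :: "('o, 'a, 'm) cat_scheme \<Rightarrow> 'o \<Rightarrow> 'p::order set \<Rightarrow>
    ('p, 'p \<times> 'p, 'o, 'a) functr \<Rightarrow> ('p, 'p \<times> 'p, 'o, 'a) functr" where
  "terminal_extension C t D G = poset_functor UNIV (\<lambda>x. if x \<in> D then on_ob G x else t)
    (\<lambda>x y. if y \<in> D then on_arr G (x, y) else to_terminal C t (if x \<in> D then on_ob G x else t))"

definition down_closed :: "'p::order set \<Rightarrow> bool" where
  "down_closed D \<longleftrightarrow> (\<forall>y\<in>D. \<forall>x\<le>y. x \<in> D)"

lemma down_closedD: "down_closed D \<Longrightarrow> y \<in> D \<Longrightarrow> x \<le> y \<Longrightarrow> x \<in> D"
  by (auto simp: down_closed_def)

locale terminal_category =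
  fixes C :: "('o, 'a, 'm) cat_scheme" and t :: 'o
  assumes cat: "category C" and terminal: "terminal C t"
begin

lemmas comp = category_comp[OF cat] and assoc = category_assoc[OF cat]
  and id_right = category_id_right[OF cat]

lemma terminal_extension_functor:
  assumes "down_closed D" "G \<in> functors (subposet_cat D) C"
  shows "terminal_extension C t D G \<in> functors (subposet_cat UNIV) C"
  unfolding terminal_extension_def
proof (rule poset_functor_functors, goal_cases)
  case (1 x)
  then show ?case using functor_ob[OF assms(2)] terminal_Ob[OF terminal] by auto
next
  case (2 x)
  then show ?case
    using functor_id[OF assms(2)] terminal_unique[OF terminal, of t] terminal_Ob[OF terminal]
      category_id[OF cat, of t] to_terminal_Hom[OF terminal] by auto
next
  case (3 x y)
  then show ?case
    using down_closedD[OF assms(1), of y x] functor_arr[OF assms(2), of x y] to_terminal_Hom[OF terminal]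
      functor_ob[OF assms(2)] terminal_Ob[OF terminal] by auto
next
  case (4 x y z)
  let ?o = "\<lambda>x. if x \<in> D then on_ob G x else t"
  have o: "?o x \<in> Ob C" for x
    using functor_ob[OF assms(2)] terminal_Ob[OF terminal] by auto
  show ?case
  proof (cases "z \<in> D")
    case True
    then show ?thesis
      using down_closedD[OF assms(1), of z] 4 functor_Comp[OF assms(2), of x y z] by (auto dest: order_trans)
  next
    case False
    have "(if y \<in> D then on_arr G (x, y) else to_terminal C t (?o x)) \<in> Hom C (?o x) (?o y)"
      using 4 down_closedD[OF assms(1), of y x] functor_arr[OF assms(2), of x y] to_terminal_Hom[OF terminal o]
      by auto
    from comp[OF this to_terminal_Hom[OF terminal o]] show ?thesis
      using False terminal_unique[OF terminal o _ to_terminal_Hom[OF terminal o]] by fastforce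
  qed
qed

text \<open>Off \<open>D\<close> the component is forced, and a square ending there commutes because
  its last vertex is terminal. A square ending inside \<open>D\<close> lies in \<open>D\<close>
  entirely, by down-closure, and is covered by the hypothesis on \<open>\<alpha>\<close>.\<close>

lemma natural_on_terminal_extension:
  assumes "down_closed D" "G \<in> functors (subposet_cat D) C" "F \<in> functors (subposet_cat I) C"
    and "natural_on C (D \<inter> I) F G \<alpha>"
  shows "natural_on C I F (terminal_extension C t D G)
    (\<lambda>x. if x \<in> D then \<alpha> x else to_terminal C t (on_ob F x))"
proof (rule natural_onI, goal_cases)
  case (1 x)
  then show ?case
    using natural_on_hom[OF assms(4), of x] to_terminal_Hom[OF terminal functor_ob[OF assms(3)], of x]
    by (auto simp: terminal_extension_def)
next
  case (2 x y)
  let ?E = "terminal_extension C t D G"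
  let ?a = "\<lambda>x. if x \<in> D then \<alpha> x else to_terminal C t (on_ob F x)"
  have h: "?a x \<in> Hom C (on_ob F x) (on_ob ?E x)" if "x \<in> I" for x
    using natural_on_hom[OF assms(4), of x] to_terminal_Hom[OF terminal functor_ob[OF assms(3)], of x] that
    by (auto simp: terminal_extension_def)
  have e: "on_arr ?E (x, y) \<in> Hom C (on_ob ?E x) (on_ob ?E y)"
    using functor_arr[OF terminal_extension_functor[OF assms(1,2)]] 2 by simp
  show ?case
  proof (cases "y \<in> D")
    case True
    then show ?thesis
      using down_closedD[OF assms(1), of y x] 2 natural_on_eq[OF assms(4), of x y]
      by (simp add: terminal_extension_def)
  next
    case False
    then have "on_ob ?E y = t" by (simp add: terminal_extension_def)
    then show ?thesis
      using comp[OF h e] comp[OF functor_arr[OF assms(3)] h, of x y] 2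
        terminal_unique[OF terminal functor_ob[OF assms(3)]] by metis
  qed
qed

end

locale kan_extension = terminal_category C t
  for C :: "('o, 'a, 'm) cat_scheme" and t +
  fixes I :: "'p::order set" and Q T \<eta>
  assumes kan: "left_kan_extension (subposet_cat I) (subposet_cat UNIV) C Q T \<eta>"
begin

lemma T_functor: "T \<in> functors (subposet_cat UNIV) C"
  and unit_Hom: "\<eta> \<in> Hom (fun_cat (subposet_cat I) C) Q (restrict_functor (subposet_cat I) T)"
  using kan by (auto simp: left_kan_extension_def)

lemma Q_functor: "Q \<in> functors (subposet_cat I) C"
  using unit_Hom by (simp add: Hom_fun_cat_iff)

lemma unit_natural: "natural_on C I Q T (component \<eta>)"
  using unit_Hom by (simp add: Hom_fun_cat_iff)

lemma T_arr: "x \<le> y \<Longrightarrow> on_arr T (x, y) \<in> Hom C (on_ob T x) (on_ob T y)"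
  and T_comp: "x \<le> y \<Longrightarrow> y \<le> z \<Longrightarrow> Comp C (on_arr T (y, z)) (on_arr T (x, y)) = on_arr T (x, z)"
  and T_id: "on_arr T (x, x) = Ide C (on_ob T x)"
  using functor_arr[OF T_functor] functor_Comp[OF T_functor] functor_id[OF T_functor] by auto

section \<open>The universal property of \<open>T\<close>, globally and over down-closed
  sets\<close>

lemma kan_ex1:
  assumes "G \<in> functors (subposet_cat UNIV) C" "natural_on C I Q G \<alpha>"
  shows "\<exists>!\<beta>. \<beta> \<in> Hom (fun_cat (subposet_cat UNIV) C) T G \<and>
    (\<forall>x\<in>I. Comp C (component \<beta> x) (component \<eta> x) = \<alpha> x)"
proof -
  let ?r = "restrict_functor (subposet_cat I)"
  have n: "natural_on C I Q (?r G) \<alpha>"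
    using assms(2) by simp
  have G: "?r G \<in> functors (subposet_cat I) C"
    using restrict_functor_subposet[OF assms(1)] by simp
  let ?a = "NatTrans Q (?r G) (restrict \<alpha> I)"
  have a: "?a \<in> Hom (fun_cat (subposet_cat I) C) Q (?r G)"
    by (rule Hom_fun_catI[OF Q_functor G n])
  have "Comp (fun_cat (subposet_cat I) C) (restrict_nattrans (subposet_cat I) \<beta>) \<eta> = ?a \<longleftrightarrow>
     (\<forall>x\<in>I. Comp C (component \<beta> x) (component \<eta> x) = \<alpha> x)"
    if "\<beta> \<in> Hom (fun_cat (subposet_cat UNIV) C) T G" for \<beta>
  proof -
    note c = fun_cat_comp[OF cat unit_Hom restrict_nattrans_Hom[OF that subset_UNIV]]
    have "Comp (fun_cat (subposet_cat I) C) (restrict_nattrans (subposet_cat I) \<beta>) \<eta> = ?a \<longleftrightarrow>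
      (\<forall>x\<in>I. component (Comp (fun_cat (subposet_cat I) C) (restrict_nattrans (subposet_cat I) \<beta>) \<eta>) x
        = component ?a x)"
      using Hom_fun_cat_eqI[OF c a] by auto
    then show ?thesis by (simp add: component_Comp_fun_cat)
  qed
  moreover have "\<exists>!\<beta>. \<beta> \<in> Hom (fun_cat (subposet_cat UNIV) C) T G \<and>
     Comp (fun_cat (subposet_cat I) C) (restrict_nattrans (subposet_cat I) \<beta>) \<eta> = ?a"
    using kan assms(1) a unfolding left_kan_extension_def by auto
  ultimately show ?thesis
    by (smt (verit, best))
qed

text \<open>Existence half of the local universal property: on \<open>D\<close>, the functor
  \<open>T\<close> behaves as the Kan extension of \<open>Q\<close> restricted to
  \<open>D \<inter> I\<close>. It is the global property tested against the extension of
  \<open>G\<close> by the terminal object.\<close>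

lemma kan_down_closed:
  assumes D: "down_closed D" and G: "G \<in> functors (subposet_cat D) C"
    and \<alpha>: "natural_on C (D \<inter> I) Q G \<alpha>"
  obtains \<beta> where "natural_on C D T G \<beta>"
    "\<And>x. x \<in> D \<Longrightarrow> x \<in> I \<Longrightarrow> Comp C (\<beta> x) (component \<eta> x) = \<alpha> x"
proof -
  let ?E = "terminal_extension C t D G"
  obtain \<beta> where b: "\<beta> \<in> Hom (fun_cat (subposet_cat UNIV) C) T ?E"
    "\<forall>x\<in>I. Comp C (component \<beta> x) (component \<eta> x) = (if x \<in> D then \<alpha> x else to_terminal C t (on_ob Q x))"
    using kan_ex1[OF terminal_extension_functor[OF D G]
        natural_on_terminal_extension[OF D G Q_functor \<alpha>]] by blast
  have "natural_on C D T ?E (component \<beta>)"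
    using b(1) natural_on_subset[OF _ subset_UNIV] by (auto simp: Hom_fun_cat_iff)
  then have "natural_on C D T G (component \<beta>)"
    using natural_on_cong[of D T T ?E G "component \<beta>" "component \<beta>" C] by (simp add: terminal_extension_def)
  with b(2) that show ?thesis by auto
qed

text \<open>Uniqueness half: both families extend to all of the poset by the maps to the terminal
  object, and the extensions agree after the unit, hence agree.\<close>

lemma kan_unique:
  assumes D: "down_closed D" and G: "G \<in> functors (subposet_cat D) C"
    and \<beta>: "natural_on C D T G \<beta>" and \<gamma>: "natural_on C D T G \<gamma>"
    and eq: "\<And>x. x \<in> D \<Longrightarrow> x \<in> I \<Longrightarrow> Comp C (\<beta> x) (component \<eta> x) = Comp C (\<gamma> x) (component \<eta> x)"
    and x: "x \<in> D"
  shows "\<beta> x = \<gamma> x"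
proof -
  let ?E = "terminal_extension C t D G"
  let ?e = "\<lambda>\<beta>. NatTrans T ?E (restrict (\<lambda>x. if x \<in> D then \<beta> x else to_terminal C t (on_ob T x)) UNIV)"
  have E: "?E \<in> functors (subposet_cat UNIV) C"
    by (rule terminal_extension_functor[OF D G])
  have e: "?e \<beta> \<in> Hom (fun_cat (subposet_cat UNIV) C) T ?E" if "natural_on C D T G \<beta>" for \<beta>
    using that by (intro Hom_fun_catI T_functor E natural_on_terminal_extension D G) auto
  let ?a = "\<lambda>x. Comp C (component (?e \<beta>) x) (component \<eta> x)"
  have nb: "natural_on C UNIV T ?E (component (?e \<beta>))"
    using e[OF \<beta>] by (simp add: Hom_fun_cat_iff)
  have "natural_on C I Q ?E ?a"
    by (rule natural_on_comp[OF cat unit_natural natural_on_subset[OF nb] Q_functor T_functor E]) auto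
  from kan_ex1[OF E this] e[OF \<beta>] e[OF \<gamma>]
  have "?e \<beta> = ?e \<gamma>"
    using eq by (smt (verit) nattrans.sel(3) restrict_UNIV UNIV_I restrict_apply')
  from arg_cong[OF this, of "\<lambda>s. component s x"] x show ?thesis by simp
qed


text \<open>Extending along a full inclusion does not change the values on \<open>I\<close>. The
  inverse of the unit at \<open>v\<close> comes from testing the local universal property over
  \<open>{y. y \<le> v}\<close> on the constant functor at \<open>on_ob Q v\<close>, which receives
  the cocone of the arrows into \<open>v\<close>.\<close>

lemma unit_iso:
  assumes v: "v \<in> I"
  obtains \<beta> where "\<beta> \<in> Hom C (on_ob T v) (on_ob Q v)"
    "Comp C \<beta> (component \<eta> v) = Ide C (on_ob Q v)" "Comp C (component \<eta> v) \<beta> = Ide C (on_ob T v)"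
proof -
  let ?D = "{y. y \<le> v}"
  have D: "down_closed ?D" by (auto simp: down_closed_def)
  note TD = restrict_functor_subposet[OF T_functor subset_UNIV, of ?D]
  note Qv = functor_ob[OF Q_functor v] and Tv = functor_ob[OF T_functor UNIV_I, of v]
  note \<eta> = natural_on_hom[OF unit_natural]
  let ?c = "\<lambda>c. poset_functor ?D (\<lambda>_. c) (\<lambda>_ _. Ide C c)"
  have "natural_on C (?D \<inter> I) Q (?c (on_ob Q v)) (\<lambda>u. on_arr Q (u, v))"
    unfolding natural_on_const[OF cat Q_functor Int_lower2 Int_lower1 Qv]
    using functor_arr[OF Q_functor] functor_Comp[OF Q_functor] v by auto
  then obtain \<beta> where \<beta>: "natural_on C ?D T (?c (on_ob Q v)) \<beta>"
    "\<And>x. x \<in> ?D \<Longrightarrow> x \<in> I \<Longrightarrow> Comp C (\<beta> x) (component \<eta> x) = on_arr Q (x, v)"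
    using kan_down_closed[OF D const_functor[OF cat Qv]] by blast
  note \<beta>1 = \<beta>(1)[unfolded natural_on_const[OF cat T_functor subset_UNIV subset_refl Qv]]
  have bh: "\<beta> x \<in> Hom C (on_ob T x) (on_ob Q v)" if "x \<le> v" for x
    using \<beta>1 that by auto
  have id: "Comp C (\<beta> v) (component \<eta> v) = Ide C (on_ob Q v)"
    using \<beta>(2)[of v] v functor_id[OF Q_functor v] by simp
  have n1: "natural_on C ?D T (?c (on_ob T v)) (\<lambda>x. on_arr T (x, v))"
    unfolding natural_on_const[OF cat T_functor subset_UNIV subset_refl Tv]
    using T_arr T_comp by auto
  have n2: "natural_on C ?D T (?c (on_ob T v)) (\<lambda>x. Comp C (component \<eta> v) (\<beta> x))"
    unfolding natural_on_const[OF cat T_functor subset_UNIV subset_refl Tv]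
  proof (intro conjI ballI impI)
    fix x assume "x \<in> ?D"
    then show "Comp C (component \<eta> v) (\<beta> x) \<in> Hom C (on_ob T x) (on_ob T v)"
      using comp[OF bh \<eta>[OF v]] by simp
  next
    fix x y assume xy: "x \<in> ?D" "y \<in> ?D" "x \<le> y"
    then show "Comp C (Comp C (component \<eta> v) (\<beta> y)) (on_arr T (x, y)) = Comp C (component \<eta> v) (\<beta> x)"
      using assoc[OF T_arr bh \<eta>[OF v]] \<beta>1 by simp
  qed
  \<comment> \<open>Both sides are values at \<open>v\<close> of cocones from \<open>T\<close> to
    \<open>on_ob T v\<close>, so it is enough to compare them after the unit.\<close>
  have "Comp C (component \<eta> v) (\<beta> v) = on_arr T (v, v)"
  proof (rule kan_unique[OF D const_functor[OF cat Tv] n2 n1])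
    fix x assume x: "x \<in> ?D" "x \<in> I"
    then show "Comp C (Comp C (component \<eta> v) (\<beta> x)) (component \<eta> x) =
        Comp C (on_arr T (x, v)) (component \<eta> x)"
      using assoc[OF \<eta> bh \<eta>[OF v]] \<beta>(2) natural_on_eq[OF unit_natural _ v] by simp
  qed simp
  with that[OF bh id] T_id show ?thesis by simp
qed

end

text \<open>The assumptions make \<open>\<phi>\<close> left adjoint to \<open>g\<close>, with
  \<open>K\<close> embedded in \<open>D\<close> as a reflective subposet. Restricting along
  \<open>g\<close> is therefore left Kan extension along \<open>\<phi>\<close>. The intended
  \<open>g\<close> is the vertex map on the proper subsets of \<open>{0..n}\<close>, and
  \<open>D\<close> the set of elements below some \<open>x i\<close>.\<close>

locale kan_along_reflection = kan_extension C t I Q T \<eta>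
  for C :: "('o, 'a, 'm) cat_scheme" and t and I :: "'p::order set" and Q T \<eta> +
  fixes K :: "'k::order set" and g :: "'k \<Rightarrow> 'p" and D :: "'p set" and \<phi> :: "'p \<Rightarrow> 'k"
  assumes D: "down_closed D" and g_mono: "mono_on K g" and \<phi>_mono: "mono_on D \<phi>"
    and g_D: "S \<in> K \<Longrightarrow> g S \<in> D" and \<phi>_K: "y \<in> D \<Longrightarrow> \<phi> y \<in> K"
    and \<phi>_g: "S \<in> K \<Longrightarrow> \<phi> (g S) = S" and le_g_\<phi>: "y \<in> D \<Longrightarrow> y \<le> g (\<phi> y)"
begin

abbreviation "pull G \<equiv> poset_functor D (\<lambda>y. on_ob G (\<phi> y)) (\<lambda>x y. on_arr G (\<phi> x, \<phi> y))"
abbreviation "TK \<equiv> poset_functor K (\<lambda>S. on_ob T (g S)) (\<lambda>R S. on_arr T (g R, g S))"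

lemma pull_functor: "G \<in> functors (subposet_cat K) C \<Longrightarrow> pull G \<in> functors (subposet_cat D) C"
  using pullback_functor[of G K C \<phi> D] \<phi>_mono \<phi>_K by auto

lemma TK_functor: "TK \<in> functors (subposet_cat K) C"
  using pullback_functor[OF T_functor _ g_mono] by auto

lemma g_le: "R \<in> K \<Longrightarrow> S \<in> K \<Longrightarrow> R \<le> S \<Longrightarrow> g R \<le> g S"
  and \<phi>_le: "x \<in> D \<Longrightarrow> y \<in> D \<Longrightarrow> x \<le> y \<Longrightarrow> \<phi> x \<le> \<phi> y"
  using g_mono \<phi>_mono by (auto simp: mono_on_def)

text \<open>The transpose of a map \<open>TK \<rightarrow> H\<close> to a map from \<open>T\<close>
  on \<open>D\<close> to the pullback of \<open>H\<close> along \<open>\<phi>\<close>; the arrow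
  from \<open>y\<close> to \<open>g (\<phi> y)\<close> is the unit of the reflection.\<close>

definition "mate b = (\<lambda>y. Comp C (b (\<phi> y)) (on_arr T (y, g (\<phi> y))))"

lemma natural_on_mate:
  assumes H: "H \<in> functors (subposet_cat K) C" and b: "natural_on C K TK H b"
  shows "natural_on C D T (pull H) (mate b)"
proof (rule natural_onI)
  have bh: "b (\<phi> x) \<in> Hom C (on_ob T (g (\<phi> x))) (on_ob H (\<phi> x))" if "x \<in> D" for x
    using natural_on_hom[OF b \<phi>_K] that \<phi>_K by simp
  {
    fix x assume "x \<in> D"
    then show "mate b x \<in> Hom C (on_ob T x) (on_ob (pull H) x)"
      using comp[OF T_arr bh] le_g_\<phi> unfolding mate_def by simp
  }
  fix x y assume xy: "x \<in> D" "y \<in> D" "x \<le> y"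
  note l = \<phi>_le[OF xy] \<phi>_K[OF xy(1)] \<phi>_K[OF xy(2)]
  note gl = g_le[OF l(2,3,1)] and p = le_g_\<phi>[OF xy(1)] le_g_\<phi>[OF xy(2)]
  have "Comp C (mate b y) (on_arr T (x, y)) = Comp C (b (\<phi> y)) (on_arr T (x, g (\<phi> y)))"
    unfolding mate_def using assoc[OF T_arr T_arr bh] T_comp xy p by simp
  also have "\<dots> = Comp C (Comp C (b (\<phi> y)) (on_arr T (g (\<phi> x), g (\<phi> y)))) (on_arr T (x, g (\<phi> x)))"
    using assoc[OF T_arr T_arr bh, of x "g (\<phi> x)"] T_comp xy p gl by simp
  also have "\<dots> = Comp C (Comp C (on_arr H (\<phi> x, \<phi> y)) (b (\<phi> x))) (on_arr T (x, g (\<phi> x)))"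
    using natural_on_eq[OF b l(2,3,1)] l by simp
  also have "\<dots> = Comp C (on_arr (pull H) (x, y)) (mate b x)"
    unfolding mate_def using assoc[OF T_arr bh functor_arr[OF H]] xy p l by simp
  finally show "Comp C (mate b y) (on_arr T (x, y)) = Comp C (on_arr (pull H) (x, y)) (mate b x)" .
qed

lemma mate_g:
  assumes "H \<in> functors (subposet_cat K) C" "natural_on C K TK H b" "S \<in> K"
  shows "mate b (g S) = b S"
  using natural_on_hom[OF assms(2,3)] assms(3) by (simp add: mate_def \<phi>_g T_id id_right)

text \<open>Since \<open>v\<close> is the top of \<open>{y. y \<le> v}\<close>, a map out of
  \<open>on_ob T v\<close> is a cocone on \<open>T\<close> over this set, and such a cocone is
  determined by \<open>Q\<close> on the part of \<open>I\<close> below \<open>v\<close>. That part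
  lies in \<open>D\<close>, so cocones on \<open>T\<close> over \<open>D\<close> give the same data,
  and these are the transposes of cocones on \<open>TK\<close>.\<close>

lemma colimit_TK:
  assumes "\<And>y. y \<in> D \<Longrightarrow> y \<le> v" and "\<And>u. u \<in> I \<Longrightarrow> u \<le> v \<Longrightarrow> u \<in> D"
  shows "colimit (subposet_cat K) C TK (on_ob T v) (\<lambda>S. on_arr T (g S, v))"
proof -
  let ?V = "{y. y \<le> v}"
  let ?c = "\<lambda>A c. poset_functor A (\<lambda>_. c) (\<lambda>_ _. Ide C c)"
  have V: "down_closed ?V" by (auto simp: down_closed_def)
  have DV: "D \<subseteq> ?V" using assms by auto
  note Tv = functor_ob[OF T_functor UNIV_I, of v]
  note \<eta> = natural_on_hom[OF unit_natural]
  have gv: "S \<in> K \<Longrightarrow> g S \<le> v" for S using assms g_D by auto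
  have "cocone (subposet_cat K) C TK (on_ob T v) (\<lambda>S. on_arr T (g S, v))"
    using gv Tv T_arr T_comp g_le by (auto simp: cocone_def)
  moreover have "\<exists>!w. w \<in> Hom C (on_ob T v) c \<and> (\<forall>S\<in>K. Comp C w (on_arr T (g S, v)) = \<iota> S)"
    if coc: "cocone (subposet_cat K) C TK c \<iota>" for c \<iota>
  proof -
    have c: "c \<in> Ob C" using coc by (simp add: cocone_def)
    have \<iota>: "natural_on C K TK (?c K c) \<iota>"
      unfolding natural_on_const[OF cat TK_functor subset_refl subset_refl c]
      using coc by (auto simp: cocone_def)
    have "natural_on C D T (pull (?c K c)) (mate \<iota>)"
      by (rule natural_on_mate[OF const_functor[OF cat c] \<iota>])
    then have m: "natural_on C D T (?c D c) (mate \<iota>)"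
      using natural_on_cong[of D T T "pull (?c K c)" "?c D c" "mate \<iota>" "mate \<iota>" C] \<phi>_K \<phi>_le by simp
    \<comment> \<open>The transposed cocone lives on \<open>D\<close> only. After the unit it is a
      cocone on \<open>Q\<close> over all of \<open>?V \<inter> I\<close>, because this set is
      contained in \<open>D\<close>; in that form it extends to \<open>T\<close> over
      \<open>?V\<close>.\<close>
    have "natural_on C (?V \<inter> I) Q (?c D c) (\<lambda>u. Comp C (mate \<iota> u) (component \<eta> u))"
      using assms(2)
      by (intro natural_on_comp[OF cat natural_on_subset[OF unit_natural] natural_on_subset[OF m]
          Q_functor T_functor const_functor[OF cat c]]) auto
    then have "natural_on C (?V \<inter> I) Q (?c ?V c) (\<lambda>u. Comp C (mate \<iota> u) (component \<eta> u))"
      using natural_on_cong[of "?V \<inter> I" Q Q "?c D c" "?c ?V c"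
          "\<lambda>u. Comp C (mate \<iota> u) (component \<eta> u)" "\<lambda>u. Comp C (mate \<iota> u) (component \<eta> u)" C]
        assms(2) by simp
    from kan_down_closed[OF V const_functor[OF cat c] this] obtain \<beta> where
      \<beta>: "natural_on C ?V T (?c ?V c) \<beta>"
        "\<And>x. x \<in> ?V \<Longrightarrow> x \<in> I \<Longrightarrow> Comp C (\<beta> x) (component \<eta> x) = Comp C (mate \<iota> x) (component \<eta> x)"
      by blast
    note \<beta>1 = \<beta>(1)[unfolded natural_on_const[OF cat T_functor subset_UNIV subset_refl c]]
    have \<beta>D: "natural_on C D T (?c D c) \<beta>"
      using natural_on_subset[OF \<beta>(1) DV] DV
        natural_on_cong[of D T T "?c ?V c" "?c D c" \<beta> \<beta> C] by (simp add: subset_iff)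
    have "\<beta> y = mate \<iota> y" if "y \<in> D" for y
      using kan_unique[OF D const_functor[OF cat c] \<beta>D m _ that] \<beta>(2) DV by auto
    then have "Comp C (\<beta> v) (on_arr T (g S, v)) = \<iota> S" if "S \<in> K" for S
      using \<beta>1 gv[OF that] g_D[OF that] mate_g[OF const_functor[OF cat c] \<iota> that] by simp
    moreover have "\<beta> v \<in> Hom C (on_ob T v) c"
      using \<beta>1 by simp
    moreover have "w = w'"
      if w: "w \<in> Hom C (on_ob T v) c" "w' \<in> Hom C (on_ob T v) c"
        "\<forall>S\<in>K. Comp C w (on_arr T (g S, v)) = Comp C w' (on_arr T (g S, v))" for w w'
    proof -
      have n: "natural_on C ?V T (?c ?V c) (\<lambda>y. Comp C w (on_arr T (y, v)))"
        if "w \<in> Hom C (on_ob T v) c" for w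
        unfolding natural_on_const[OF cat T_functor subset_UNIV subset_refl c]
        using comp[OF T_arr that] assoc[OF T_arr T_arr that] T_comp by auto
      have "Comp C w (on_arr T (v, v)) = Comp C w' (on_arr T (v, v))"
      proof (rule kan_unique[OF V const_functor[OF cat c] n[OF w(1)] n[OF w(2)]])
        fix x assume x: "x \<in> ?V" "x \<in> I"
        then have xD: "x \<in> D" using assms(2) by auto
        note h = le_g_\<phi>[OF xD] gv[OF \<phi>_K[OF xD]]
        \<comment> \<open>The arrow from \<open>x\<close> to \<open>v\<close> passes through
          \<open>g (\<phi> x)\<close>, where \<open>w\<close> and \<open>w'\<close> agree by
          assumption.\<close>
        have "Comp C w (on_arr T (x, v)) = Comp C (Comp C w (on_arr T (g (\<phi> x), v))) (on_arr T (x, g (\<phi> x)))"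
          if "w \<in> Hom C (on_ob T v) c" for w
          using assoc[OF T_arr T_arr that] T_comp h by simp
        then have "Comp C w (on_arr T (x, v)) = Comp C w' (on_arr T (x, v))"
          using w \<phi>_K[OF xD] by simp
        then show "Comp C (Comp C w (on_arr T (x, v))) (component \<eta> x) =
            Comp C (Comp C w' (on_arr T (x, v))) (component \<eta> x)" by simp
      qed simp
      then show ?thesis using w T_id id_right by metis
    qed
    ultimately show ?thesis by metis
  qed
  ultimately show ?thesis by (simp add: colimit_def)
qed

end

section \<open>Model categories\<close>

lemma model_category_category: "model_category U M \<Longrightarrow> category M"
  by (simp add: model_category_def)

lemma model_category_terminal_initial:
  assumes "model_category TYPE('i) M"
  obtains t z where "terminal M t" "initial M z"
proof -
  let ?J = "\<lparr>Ob = {}, Arr = {}, Dom = id, Cod = id, Ide = id, Comp = (\<lambda>_ _. undefined)\<rparr> :: ('i, 'i) cat"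
  \<comment> \<open>The only extensional functor on the empty category; its limit is terminal and
    its colimit initial.\<close>
  let ?D = "Functr (\<lambda>_. undefined) (\<lambda>_. undefined)"
  have "category ?J" "?D \<in> functors ?J M"
    by (auto simp: category_def functors_def)
  then obtain t \<pi> z \<iota> where "limit ?J M ?D t \<pi>" "colimit ?J M ?D z \<iota>"
    using assms unfolding model_category_def bicomplete_def by metis
  then have "terminal M t" "initial M z"
    by (auto simp: limit_def colimit_def cone_def cocone_def terminal_def initial_def)
  then show ?thesis by (rule that)
qed

text \<open>A factorization of the identity as \<open>i\<close> followed by a trivial fibration
  \<open>p\<close> exhibits it as a retract of \<open>p\<close>.\<close>

lemma model_category_id:
  assumes M: "model_category U M" and x: "x \<in> Ob M"
  shows "Ide M x \<in> Weq M" "Ide M x \<in> Fib M"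
proof -
  have cat: "category M" by (rule model_category_category[OF M])
  note id = category_id[OF cat]
  have "Ide M x \<in> Arr M" using id[OF x] by (simp add: Hom_def)
  with M obtain i p where ip: "i \<in> Cof M" "p \<in> Fib M \<inter> Weq M" "Cod M i = Dom M p"
    "Comp M p i = Ide M x"
    unfolding model_category_def factorizes_def by blast
  have a: "i \<in> Arr M" "p \<in> Arr M"
    using ip M by (auto simp: model_category_def)
  have "Comp M p i \<in> Hom M (Dom M i) (Cod M p)"
    using a ip(3) category_comp[OF cat, of i _ "Cod M i" p] by (simp add: Hom_def)
  then have d: "Dom M i = x" "Cod M p = x"
    using ip(4) id[OF x] by (auto simp: Hom_def)
  then have h: "i \<in> Hom M x (Dom M p)" "p \<in> Hom M (Dom M p) x"
    using a ip(3) by (auto simp: Hom_def)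
  have di: "Dom M (Ide M x) = x" "Cod M (Ide M x) = x" "Ide M x \<in> Arr M"
    using id[OF x] by (auto simp: Hom_def)
  have "retract_of M (Ide M x) p"
    unfolding retract_of_def di d using h di a id[OF x] ip(4) category_id_left[OF cat]
      category_id_right[OF cat]
    by (intro conjI bexI[of _ i] bexI[of _ p] bexI[of _ "Ide M x"]) auto
  then show "Ide M x \<in> Weq M" "Ide M x \<in> Fib M"
    using M ip(2) unfolding model_category_def closed_under_retracts_def by blast+
qed

text \<open>An isomorphism is a retract of the identity of its source.\<close>

lemma model_category_iso:
  assumes M: "model_category U M" and f: "f \<in> Hom M x y" and g: "g \<in> Hom M y x"
    and "Comp M g f = Ide M x" "Comp M f g = Ide M y"
  shows "f \<in> Weq M"
proof -
  have cat: "category M" by (rule model_category_category[OF M])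
  have x: "x \<in> Ob M" by (rule category_dom[OF cat f])
  note id = category_id[OF cat x]
  have d: "Dom M f = x" "Cod M f = y" "Dom M (Ide M x) = x" "Cod M (Ide M x) = x"
    "f \<in> Arr M" "Ide M x \<in> Arr M"
    using f id by (auto simp: Hom_def)
  have "retract_of M f (Ide M x)"
    unfolding retract_of_def d using assms(4,5) f g id d category_id_left[OF cat]
      category_id_right[OF cat]
    by (intro conjI bexI[of _ "Ide M x"] bexI[of _ g] bexI[of _ f]) auto
  then show ?thesis
    using M model_category_id(1)[OF M x] unfolding model_category_def closed_under_retracts_def by blast
qed

section \<open>Projective cofibrancy as a lifting property\<close>

lemma Hom_projective: "Hom (projective J M) = Hom (fun_cat J M)"
  by (simp add: fun_eq_iff Hom_def projective_def Let_def)

lemma initial_projective: "initial (projective J M) = initial (fun_cat J M)"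
  by (simp add: fun_eq_iff initial_def Hom_projective) (simp add: projective_def Let_def)

lemma initial_const_functor:
  assumes cat: "category M" and z: "initial M z"
  shows "initial (fun_cat (subposet_cat A) M) (poset_functor A (\<lambda>_. z) (\<lambda>_ _. Ide M z))"
    (is "initial ?N ?z")
proof -
  have zO: "z \<in> Ob M" using z by (simp add: initial_def)
  have uni: "f = g" if "f \<in> Hom M z x" "g \<in> Hom M z x" for f g x
    using z category_cod[OF cat that(1)] that unfolding initial_def by blast
  have zf: "?z \<in> functors (subposet_cat A) M" by (rule const_functor[OF cat zO])
  define i where "i x = (THE f. f \<in> Hom M z x)" for x
  have i: "i x \<in> Hom M z x" if "x \<in> Ob M" for x
    unfolding i_def by (rule theI') (use z that in \<open>simp add: initial_def\<close>)
  have "\<exists>!f. f \<in> Hom ?N ?z G" if G: "G \<in> functors (subposet_cat A) M" for G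
  proof -
    have n: "natural_on M A ?z G (\<lambda>x. i (on_ob G x))"
    proof (rule natural_onI)
      fix x assume "x \<in> A"
      then show "i (on_ob G x) \<in> Hom M (on_ob ?z x) (on_ob G x)"
        using i functor_ob[OF G] by simp
    next
      fix x y assume xy: "x \<in> A" "y \<in> A" "x \<le> y"
      then show "Comp M (i (on_ob G y)) (on_arr ?z (x, y)) = Comp M (on_arr G (x, y)) (i (on_ob G x))"
        using uni[of "i (on_ob G y)" "on_ob G y" "Comp M (on_arr G (x, y)) (i (on_ob G x))"]
          i category_comp[OF cat i functor_arr[OF G]] functor_ob[OF G]
        by (simp add: category_id_right[OF cat, of _ z "on_ob G y"])
    qed
    show ?thesis
    proof (intro ex1I, rule Hom_fun_catI[OF zf G n], rule Hom_fun_cat_eqI[OF _ Hom_fun_catI[OF zf G n]])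
      fix f x assume f: "f \<in> Hom ?N ?z G" and x: "x \<in> A"
      have "component f x \<in> Hom M z (on_ob G x)"
        using f x natural_on_hom[of M A ?z G "component f" x] by (simp add: Hom_fun_cat_iff)
      then show "component f x = component (NatTrans ?z G (restrict (\<lambda>x. i (on_ob G x)) A)) x"
        using uni i functor_ob[OF G x] x by simp
    qed
  qed
  then show ?thesis using zf by (simp add: initial_def fun_cat_def)
qed

text \<open>The maps \<open>p\<close> are the trivial fibrations of the projective model structure.\<close>

lemma cofibrant_projective_iff:
  assumes cat: "category M" and z: "initial M z"
  shows "cofibrant (projective (subposet_cat A) M) Q \<longleftrightarrow> Q \<in> functors (subposet_cat A) M \<and>
    (\<forall>G H p b. G \<in> functors (subposet_cat A) M \<longrightarrow> H \<in> functors (subposet_cat A) M \<longrightarrow>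
      natural_on M A G H p \<longrightarrow> (\<forall>x\<in>A. p x \<in> Weq M \<inter> Fib M) \<longrightarrow> natural_on M A Q H b \<longrightarrow>
      (\<exists>h. natural_on M A Q G h \<and> (\<forall>x\<in>A. Comp M (p x) (h x) = b x)))"
    (is "?L \<longleftrightarrow> ?Q \<and> ?R")
proof
  let ?N = "fun_cat (subposet_cat A) M" and ?P = "projective (subposet_cat A) M"
  have Hom_eqI: "f = g" if "initial ?N z'" "f \<in> Hom ?N z' x" "g \<in> Hom ?N z' x" for f g z' x
  proof -
    have "x \<in> Ob ?N" using that(2) by (auto simp: Hom_fun_cat_iff) (simp add: fun_cat_def)
    then show ?thesis using that unfolding initial_def by blast
  qed
  {
    assume L: ?L
    then have Q: ?Q by (simp add: cofibrant_def projective_def Let_def fun_cat_def)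
    have ?R
    proof (intro allI impI)
      fix G H p b
      assume as: "G \<in> functors (subposet_cat A) M" "H \<in> functors (subposet_cat A) M"
        "natural_on M A G H p" "\<forall>x\<in>A. p x \<in> Weq M \<inter> Fib M" "natural_on M A Q H b"
      obtain z' f where zf: "initial ?N z'" "f \<in> Hom ?N z' Q" "f \<in> Cof ?P"
        using L by (auto simp: cofibrant_def initial_projective Hom_projective)
      let ?p = "NatTrans G H (restrict p A)" and ?b = "NatTrans Q H (restrict b A)"
      have p: "?p \<in> Hom ?N G H" and b: "?b \<in> Hom ?N Q H"
        using Hom_fun_catI as Q by auto
      have "has_lifts ?N f ?p"
        using zf(3) p as(4) by (auto simp: projective_def Let_def Hom_def)
      \<comment> \<open>Initiality supplies both the top edge of the lifting square and its
        commutativity, so the lifting property concerns \<open>b\<close> and \<open>p\<close>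
        alone.\<close>
      moreover obtain a where a: "a \<in> Hom ?N z' G"
        using zf(1) as(1) unfolding initial_def by (auto simp: fun_cat_def)
      moreover have "Comp ?N ?p a = Comp ?N ?b f"
        by (rule Hom_eqI[OF zf(1) fun_cat_comp[OF cat a p] fun_cat_comp[OF cat zf(2) b]])
      moreover have "Dom ?N f = z'" "Cod ?N f = Q" "Dom ?N ?p = G" "Cod ?N ?p = H"
        using p zf(2) by (auto simp: Hom_def)
      ultimately obtain h where h: "h \<in> Hom ?N Q G" "Comp ?N ?p h = ?b"
        using b unfolding has_lifts_def by metis
      have "Comp M (p x) (component h x) = b x" if "x \<in> A" for x
        using component_Comp_fun_cat[OF that, of M ?p h] h(2) that by simp
      with h(1) show "\<exists>h. natural_on M A Q G h \<and> (\<forall>x\<in>A. Comp M (p x) (h x) = b x)"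
        by (auto simp: Hom_fun_cat_iff)
    qed
    with Q show "?Q \<and> ?R" ..
  }
  assume QR: "?Q \<and> ?R"
  let ?z = "poset_functor A (\<lambda>_. z) (\<lambda>_ _. Ide M z)"
  have ini: "initial ?N ?z" by (rule initial_const_functor[OF cat z])
  have QN: "Q \<in> Ob ?N" using QR by (simp add: fun_cat_def)
  then obtain f where f: "f \<in> Hom ?N ?z Q" using ini by (auto simp: initial_def)
  have "has_lifts ?N f p"
    if p: "p \<in> Arr ?N" "\<forall>j\<in>A. component p j \<in> Fib M" "\<forall>j\<in>A. component p j \<in> Weq M" for p
    unfolding has_lifts_def
  proof (intro ballI impI)
    fix a b
    assume "a \<in> Hom ?N (Dom ?N f) (Dom ?N p)" "b \<in> Hom ?N (Cod ?N f) (Cod ?N p)"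
    moreover have d: "Dom ?N f = ?z" "Cod ?N f = Q" using f by (auto simp: Hom_def)
    ultimately have a: "a \<in> Hom ?N ?z (Dom ?N p)" and b: "b \<in> Hom ?N Q (Cod ?N p)" by auto
    have p': "p \<in> Hom ?N (Dom ?N p) (Cod ?N p)" using p by (simp add: Hom_def)
    obtain h where h: "natural_on M A Q (Dom ?N p) h" "\<And>x. x \<in> A \<Longrightarrow> Comp M (component p x) (h x) = component b x"
      using QR p p' b unfolding Hom_fun_cat_iff by blast
    let ?h = "NatTrans Q (Dom ?N p) (restrict h A)"
    have h': "?h \<in> Hom ?N Q (Dom ?N p)"
      using Hom_fun_catI[OF _ _ h(1)] QR p' by (auto simp: Hom_fun_cat_iff)
    moreover have "Comp ?N ?h f = a"
      by (rule Hom_eqI[OF ini fun_cat_comp[OF cat f h'] a])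
    moreover have "Comp ?N p ?h = b"
      by (rule Hom_fun_cat_eqI[OF fun_cat_comp[OF cat h' p'] b]) (simp add: component_Comp_fun_cat h)
    ultimately show "\<exists>h\<in>Hom ?N (Cod ?N f) (Dom ?N p). Comp ?N h f = a \<and> Comp ?N p h = b"
      unfolding d by blast
  qed
  then have "f \<in> Cof ?P"
    using f by (auto simp: projective_def Let_def Hom_def)
  then show ?L
    using ini f QN unfolding cofibrant_def initial_projective Hom_projective
    by (auto simp: projective_def Let_def)
qed

locale model_kan_along_reflection = kan_along_reflection M t I Q T \<eta> K g D \<phi>
  for M :: "('o, 'a, 'm) model_cat_scheme" and t and I :: "'p::order set" and Q T \<eta>
    and K :: "'k::order set" and g D \<phi> +
  fixes U :: "'i itself" and z
  assumes model: "model_category U M" and z: "initial M z"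
begin

text \<open>\<open>TK\<close> is the left Kan extension of \<open>Q\<close>, restricted to \<open>D \<inter> I\<close>, along \<open>\<phi>\<close>. Lifting problems for
  \<open>TK\<close> are transposed to \<open>Q\<close> by pulling back along \<open>\<phi>\<close> and extending by the terminal object, which
  preserves trivial fibrations.\<close>

lemma cofibrant_TK:
  assumes Q: "cofibrant (projective (subposet_cat I) M) Q"
  shows "cofibrant (projective (subposet_cat K) M) TK"
  unfolding cofibrant_projective_iff[OF cat z]
proof (intro conjI allI impI TK_functor)
  fix G H p b
  assume G: "G \<in> functors (subposet_cat K) M" and H: "H \<in> functors (subposet_cat K) M"
    and p: "natural_on M K G H p" and pW: "\<forall>x\<in>K. p x \<in> Weq M \<inter> Fib M" and b: "natural_on M K TK H b"
  note pG = pull_functor[OF G] and pH = pull_functor[OF H]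
  let ?EG = "terminal_extension M t D (pull G)" and ?EH = "terminal_extension M t D (pull H)"
  let ?r = "restrict_functor (subposet_cat I)"
  note EG = terminal_extension_functor[OF D pG] and EH = terminal_extension_functor[OF D pH]
  note mate = natural_on_mate[OF H b]
  have pp: "natural_on M D (pull G) (pull H) (\<lambda>y. p (\<phi> y))"
    using natural_on_hom[OF p] natural_on_eq[OF p] \<phi>_K \<phi>_le by (intro natural_onI) auto
  then have "natural_on M (D \<inter> UNIV) ?EG (pull H) (\<lambda>y. p (\<phi> y))"
    using natural_on_cong[of D "pull G" ?EG "pull H" "pull H" "\<lambda>y. p (\<phi> y)" "\<lambda>y. p (\<phi> y)" M]
    by (simp add: terminal_extension_def)
  from natural_on_subset[OF natural_on_terminal_extension[OF D pH EG this], of I]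
  have P: "natural_on M I (?r ?EG) (?r ?EH) (\<lambda>x. if x \<in> D then p (\<phi> x) else to_terminal M t (on_ob ?EG x))"
    by simp
  \<comment> \<open>Off \<open>D\<close> the extended \<open>p\<close> is the map from the terminal
    object to itself, hence an identity and a trivial fibration.\<close>
  have "to_terminal M t t = Ide M t"
    using terminal_unique[OF terminal] terminal_Ob[OF terminal] to_terminal_Hom[OF terminal]
      category_id[OF cat] by blast
  then have PW: "\<forall>x\<in>I. (if x \<in> D then p (\<phi> x) else to_terminal M t (on_ob ?EG x)) \<in> Weq M \<inter> Fib M"
    using pW \<phi>_K model_category_id[OF model terminal_Ob[OF terminal]]
    by (auto simp: terminal_extension_def)
  \<comment> \<open>The lower edge of the transposed problem: \<open>b\<close> is carried to
    \<open>T\<close> on \<open>D\<close> by \<open>mate\<close>, then to \<open>Q\<close> by the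
    unit.\<close>
  have "natural_on M (D \<inter> I) Q (pull H) (\<lambda>x. Comp M (mate b x) (component \<eta> x))"
    by (rule natural_on_comp[OF cat natural_on_subset[OF unit_natural] natural_on_subset[OF mate]
      Q_functor T_functor pH]) auto
  from natural_on_terminal_extension[OF D pH Q_functor this]
  have B: "natural_on M I Q (?r ?EH) (\<lambda>x. if x \<in> D then Comp M (mate b x) (component \<eta> x)
      else to_terminal M t (on_ob Q x))"
    by simp
  have r: "?r ?EG \<in> functors (subposet_cat I) M" "?r ?EH \<in> functors (subposet_cat I) M"
    using restrict_functor_subposet[OF EG] restrict_functor_subposet[OF EH] by auto
  obtain l where l: "natural_on M I Q (?r ?EG) l"
    "\<forall>x\<in>I. Comp M (if x \<in> D then p (\<phi> x) else to_terminal M t (on_ob ?EG x)) (l x) =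
      (if x \<in> D then Comp M (mate b x) (component \<eta> x) else to_terminal M t (on_ob Q x))"
    using Q[unfolded cofibrant_projective_iff[OF cat z]] r P PW B by blast
  have l2: "Comp M (p (\<phi> x)) (l x) = Comp M (mate b x) (component \<eta> x)" if "x \<in> D" "x \<in> I" for x
    using l(2) that by auto
  have "natural_on M (D \<inter> I) Q ?EG l"
    using natural_on_subset[of M I Q ?EG l "D \<inter> I"] l(1) by simp
  then have "natural_on M (D \<inter> I) Q (pull G) l"
    using natural_on_cong[of "D \<inter> I" Q Q ?EG "pull G" l l M] by (simp add: terminal_extension_def)
  from kan_down_closed[OF D pG this] obtain \<beta> where
    \<beta>: "natural_on M D T (pull G) \<beta>" "\<And>x. x \<in> D \<Longrightarrow> x \<in> I \<Longrightarrow> Comp M (\<beta> x) (component \<eta> x) = l x"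
    by blast
  \<comment> \<open>Transposing back is evaluation along \<open>g\<close>, as
    \<open>\<phi> (g S) = S\<close>.\<close>
  have "natural_on M K TK G (\<lambda>S. \<beta> (g S))"
    using natural_on_hom[OF \<beta>(1)] natural_on_eq[OF \<beta>(1)] g_D g_le
    by (intro natural_onI) (fastforce simp: \<phi>_g)+
  moreover have "Comp M (p S) (\<beta> (g S)) = b S" if S: "S \<in> K" for S
  proof -
    \<comment> \<open>The lift solves the problem after the unit only; uniqueness over
      \<open>D\<close> removes the unit, and \<open>mate_g\<close> identifies the result with
      \<open>b\<close>.\<close>
    have n: "natural_on M D T (pull H) (\<lambda>y. Comp M (p (\<phi> y)) (\<beta> y))"
      by (rule natural_on_comp[OF cat \<beta>(1) pp T_functor pG pH]) auto
    have "Comp M (p (\<phi> (g S))) (\<beta> (g S)) = mate b (g S)"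
    proof (rule kan_unique[OF D pH n mate _ g_D[OF S]])
      fix x assume x: "x \<in> D" "x \<in> I"
      have "p (\<phi> x) \<in> Hom M (on_ob G (\<phi> x)) (on_ob H (\<phi> x))"
        "\<beta> x \<in> Hom M (on_ob T x) (on_ob G (\<phi> x))"
        using natural_on_hom[OF p \<phi>_K[OF x(1)]] natural_on_hom[OF \<beta>(1) x(1)] x(1) by simp_all
      from assoc[OF natural_on_hom[OF unit_natural x(2)] this(2,1)]
      show "Comp M (Comp M (p (\<phi> x)) (\<beta> x)) (component \<eta> x) = Comp M (mate b x) (component \<eta> x)"
        using \<beta>(2)[OF x] l2[OF x] by simp
    qed
    then show ?thesis using S mate_g[OF H b S] by (simp add: \<phi>_g)
  qed
  ultimately show "\<exists>h. natural_on M K TK G h \<and> (\<forall>x\<in>K. Comp M (p x) (h x) = b x)"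
    by blast
qed

end

section \<open>Join-dimension\<close>

text \<open>The meet of \<open>v\<close> with \<open>x\<close> cannot be strictly below
  \<open>v\<close>.\<close>

lemma minimal_le: "minimal v \<Longrightarrow> v \<le> x" for v :: "'p::lattice"
  by (metis inf.cobounded1 inf.cobounded2 minimal_def order_less_le)

text \<open>Distributivity splits \<open>a\<close> as the join of \<open>inf a x\<close> and
  \<open>inf a y\<close>, and irreducibility forbids both from being proper.\<close>

lemma join_irreducible_prime:
  fixes a :: "'p::distrib_lattice"
  assumes "join_irreducible a" "a \<le> sup x y"
  shows "a \<le> x \<or> a \<le> y"
proof (rule ccontr)
  assume *: "\<not> (a \<le> x \<or> a \<le> y)"
  have "a = sup (inf a x) (inf a y)"
    using assms(2) by (metis inf.absorb1 inf_sup_distrib1)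
  moreover have "inf a x < a" "inf a y < a"
    using * by (auto simp: order_less_le) (metis inf.cobounded2)+
  ultimately show False using assms(1) by (auto simp: join_irreducible_def)
qed

lemma join_irreducible_Sup_fin:
  fixes a :: "'p::distrib_lattice"
  assumes "finite A" "A \<noteq> {}" "join_irreducible a" "a \<le> Sup_fin A"
  shows "\<exists>b\<in>A. a \<le> b"
  using assms(1,2,4)
proof (induction rule: finite_ne_induct)
  case (insert x F)
  then show ?case using join_irreducible_prime[OF assms(3), of x "Sup_fin F"] by auto
qed simp

text \<open>A reduced indecomposable join-decomposition as a set, so that uniqueness is an equality
  of sets. A minimal element counts as join-irreducible and its singleton qualifies, although its
  join-dimension is 0; minimality therefore has to be excluded separately below.\<close>

definition irreducible_antichain :: "'p::lattice set \<Rightarrow> bool" where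
  "irreducible_antichain A \<longleftrightarrow> finite A \<and> A \<noteq> {} \<and> (\<forall>a\<in>A. join_irreducible a) \<and>
    (\<forall>a\<in>A. \<forall>b\<in>A. a \<le> b \<longrightarrow> a = b)"

text \<open>Primeness puts each \<open>a \<in> A\<close> below some \<open>b \<in> B\<close>, and
  \<open>b\<close> below some \<open>a' \<in> A\<close>; in an antichain this forces
  \<open>a = b = a'\<close>.\<close>

lemma irreducible_antichain_unique:
  fixes A :: "'p::distrib_lattice set"
  assumes A: "irreducible_antichain A" and B: "irreducible_antichain B" and eq: "Sup_fin A = Sup_fin B"
  shows "A = B"
proof -
  have *: "A \<subseteq> B" if A: "irreducible_antichain A" and B: "irreducible_antichain B"
    and eq: "Sup_fin A = Sup_fin B" for A B :: "'p set"
  proof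
    fix a assume a: "a \<in> A"
    have "a \<le> Sup_fin B" using a A eq Sup_fin.coboundedI[of A a] by (simp add: irreducible_antichain_def)
    then obtain b where b: "b \<in> B" "a \<le> b"
      using join_irreducible_Sup_fin[of B a] a A B by (auto simp: irreducible_antichain_def)
    have "b \<le> Sup_fin A" using b B eq Sup_fin.coboundedI[of B b] by (simp add: irreducible_antichain_def)
    then obtain a' where "a' \<in> A" "b \<le> a'"
      using join_irreducible_Sup_fin[of A b] b A B by (auto simp: irreducible_antichain_def)
    then have "a = b" using a b A by (metis irreducible_antichain_def order_antisym order_trans)
    then show "a \<in> B" using b by simp
  qed
  show ?thesis using *[OF A B eq] *[OF B A eq[symmetric]] by blast
qed

lemma has_jdim_iff:
  fixes v :: "'p::distrib_lattice"
  assumes v: "\<not> minimal v"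
  shows "has_jdim v k \<longleftrightarrow> (\<exists>A. irreducible_antichain A \<and> card A = k \<and> Sup_fin A = v)"
proof
  assume "has_jdim v k"
  then obtain p where p: "k \<ge> 1" "v = Sup_fin (p ` {..<k})" "reduced v k p" "\<And>i. i < k \<Longrightarrow> join_irreducible (p i)"
    by (auto simp: has_jdim_def join_decomposition_def indecomposable_def)
  have eq: "i = j" if ij: "i < k" "j < k" "p i \<le> p j" for i j
  proof (rule ccontr)
    assume ne: "i \<noteq> j"
    then have k: "k \<noteq> 1" using ij by auto
    let ?B = "p ` ({..<k} - {i})"
    have j: "p j \<in> ?B" using ij ne by auto
    have ins: "p ` {..<k} = insert (p i) ?B" using ij(1) by auto
    have "Sup_fin (insert (p i) ?B) = sup (p i) (Sup_fin ?B)"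
      using j by (intro Sup_fin.insert) auto
    moreover have "p i \<le> Sup_fin ?B"
      using ij(3) Sup_fin.coboundedI[OF _ j] by (meson finite_Diff finite_imageI finite_lessThan order_trans)
    ultimately have "Sup_fin ?B = v" using p(2) ins by (simp add: sup.absorb2)
    then show False using p(3) k ij(1) by (auto simp: reduced_def)
  qed
  then have "inj_on p {..<k}" by (intro inj_onI) auto
  then have "card (p ` {..<k}) = k" by (simp add: card_image)
  moreover have "irreducible_antichain (p ` {..<k})"
    using p(1,4) eq by (auto simp: irreducible_antichain_def lessThan_empty_iff)
  ultimately show "\<exists>A. irreducible_antichain A \<and> card A = k \<and> Sup_fin A = v"
    using p(2) by blast
next
  assume "\<exists>A. irreducible_antichain A \<and> card A = k \<and> Sup_fin A = v"
  then obtain A where A: "irreducible_antichain A" "card A = k" "Sup_fin A = v" by blast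
  then have fin: "finite A" "A \<noteq> {}" by (auto simp: irreducible_antichain_def)
  obtain p where p: "bij_betw p {..<k} A"
    using ex_bij_betw_nat_finite[OF fin(1)] A(2) by (auto simp: atLeast0LessThan)
  have im: "p ` {..<k} = A" using p by (simp add: bij_betw_def)
  have k: "k \<ge> 1" using A(2) fin by (auto simp: Suc_le_eq card_gt_0_iff)
  have "Sup_fin (p ` ({..<k} - {i})) \<noteq> v" if i: "i < k" and "k \<noteq> 1" for i
  proof
    assume eq: "Sup_fin (p ` ({..<k} - {i})) = v"
    have pA: "p i \<in> A" using im i by blast
    have d: "p ` ({..<k} - {i}) = A - {p i}"
      using p i im by (auto simp: bij_betw_def inj_on_def)
    \<comment> \<open>\<open>k \<noteq> 1\<close> leaves a nonempty set of factors, as primeness for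
      \<open>Sup_fin\<close> requires.\<close>
    have "card (A - {p i}) = k - 1" using i im A(2) by (subst card_Diff_singleton) auto
    then have "card (A - {p i}) \<noteq> 0" using that k by simp
    then have "A - {p i} \<noteq> {}" by force
    moreover have "p i \<le> Sup_fin (A - {p i})"
      using eq d A(3) Sup_fin.coboundedI[OF fin(1) pA] by simp
    ultimately obtain b where "b \<in> A - {p i}" "p i \<le> b"
      using join_irreducible_Sup_fin[of "A - {p i}" "p i"] A(1) pA fin(1)
      by (metis finite_Diff irreducible_antichain_def)
    then show False using A(1) pA by (metis DiffE irreducible_antichain_def singletonI)
  qed
  \<comment> \<open>For \<open>k = 1\<close> the convention reads reducedness as \<open>v\<close>
    not being minimal.\<close>
  then have "reduced v k p" using v unfolding reduced_def by metis
  moreover have "join_decomposition v k p"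
    using k im A(3) by (simp add: join_decomposition_def)
  moreover have "indecomposable k p"
    using im A(1) by (auto simp: indecomposable_def irreducible_antichain_def)
  ultimately show "has_jdim v k" by (auto simp: has_jdim_def)
qed

lemma jdim_antichain:
  fixes A :: "'p::distrib_lattice set"
  assumes "irreducible_antichain A" "\<not> minimal (Sup_fin A)"
  shows "jdim (Sup_fin A) = enat (card A)"
proof -
  have "has_jdim (Sup_fin A) k \<longleftrightarrow> k = card A" for k
    unfolding has_jdim_iff[OF assms(2)] using irreducible_antichain_unique[OF _ assms(1)] assms(1) by auto
  then have "has_jdim (Sup_fin A) = (\<lambda>k. k = card A)" by blast
  then show ?thesis using assms(2) by (simp add: jdim_def)
qed

lemma jdim_finiteE:
  fixes v :: "'p::distrib_lattice"
  assumes "jdim v \<noteq> \<infinity>"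
  obtains "minimal v" | A where "irreducible_antichain A" "Sup_fin A = v" "jdim v = enat (card A)"
    "\<not> minimal v"
proof (cases "minimal v")
  case False
  then obtain k where "has_jdim v k" using assms by (auto simp: jdim_def split: if_splits)
  then show ?thesis using False has_jdim_iff[OF False] jdim_antichain that(2) by metis
qed

text \<open>A minimal element that is no finite join of irreducibles would be reducible, hence the
  join of two smaller elements that are such joins. Among the decompositions of \<open>v\<close>,
  one of least cardinality is an antichain, since a factor below another could be dropped.\<close>

lemma finite_jdim_dcc:
  fixes v :: "'q::distrib_lattice"
  assumes dcc: "\<And>A :: 'q set. A \<noteq> {} \<Longrightarrow> \<exists>m\<in>A. \<forall>y\<in>A. \<not> y < m"
  shows "jdim v \<noteq> \<infinity>"
proof -
  define R where "R v A \<longleftrightarrow> finite A \<and> A \<noteq> {} \<and> (\<forall>a\<in>A. join_irreducible a) \<and> Sup_fin A = v"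
    for v :: 'q and A
  have ex: "\<exists>A. R v A" for v
  proof (rule ccontr)
    assume "\<not> (\<exists>A. R v A)"
    then have "{v. \<not> (\<exists>A. R v A)} \<noteq> {}" by blast
    from dcc[OF this] obtain m where m: "\<not> (\<exists>A. R m A)" "\<And>y. y < m \<Longrightarrow> \<exists>A. R y A" by blast
    have "R m {m}" if "join_irreducible m" using that by (simp add: R_def)
    with m(1) obtain x y where xy: "x < m" "y < m" "m = sup x y" by (auto simp: join_irreducible_def)
    with m(2) obtain A B where "R x A" "R y B" by blast
    then have "R m (A \<union> B)" using xy(3) by (auto simp: R_def Sup_fin.union)
    with m(1) show False by blast
  qed
  then have "\<exists>A. R v A \<and> (\<forall>B. R v B \<longrightarrow> card A \<le> card B)"
    using ex_has_least_nat[of "R v" _ card] by blast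
  then obtain A where A: "R v A" "\<And>B. R v B \<Longrightarrow> card A \<le> card B" by blast
  have "a = b" if ab: "a \<in> A" "b \<in> A" "a \<le> b" for a b
  proof (rule ccontr)
    assume ne: "a \<noteq> b"
    have "Sup_fin (insert a (A - {a})) = sup a (Sup_fin (A - {a}))"
      using A(1) ab ne by (intro Sup_fin.insert) (auto simp: R_def)
    moreover have "a \<le> Sup_fin (A - {a})"
      using ab ne A(1) Sup_fin.coboundedI[of "A - {a}" b] by (auto simp: R_def)
    ultimately have "R v (A - {a})"
      using A(1) ab ne by (auto simp: R_def insert_absorb sup.absorb2)
    from A(2)[OF this] show False
      using A(1) ab card_Diff1_less[of A a] by (simp add: R_def)
  qed
  then have "irreducible_antichain A" "Sup_fin A = v"
    using A(1) by (auto simp: R_def irreducible_antichain_def)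
  then show ?thesis
    using jdim_antichain[of A] by (cases "minimal v") (auto simp: jdim_def)
qed

text \<open>Each \<open>x i\<close> omits a different factor of \<open>v\<close>, so any two of them
  together contain all factors. The factors left still form an irreducible antichain, so
  \<open>jdim\<close> can be read off their number. The clause on \<open>jdim\<close> is kept
  because it survives a map that is only monotone and preserves \<open>jdim\<close>.\<close>

lemma jdim_cover:
  fixes v b :: "'p::distrib_lattice"
  assumes b: "minimal b" and v: "enat n < jdim v" "jdim v \<noteq> \<infinity>"
  obtains x where "\<And>i. i \<le> n \<Longrightarrow> x i < v" "\<And>i. i \<le> n \<Longrightarrow> jdim (x i) \<noteq> jdim v"
    "\<And>i j. i \<le> n \<Longrightarrow> j \<le> n \<Longrightarrow> i \<noteq> j \<Longrightarrow> sup (x i) (x j) = v"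
proof -
  have nm: "\<not> minimal v" using v(1) by (auto simp: jdim_def zero_enat_def)
  obtain A where A: "irreducible_antichain A" "Sup_fin A = v" "jdim v = enat (card A)"
    using jdim_finiteE[OF v(2)] nm by metis
  have fin: "finite A" and n: "n < card A" using A v by (auto simp: irreducible_antichain_def)
  have less: "y < v" if "y \<le> v" "jdim y \<noteq> jdim v" for y
    using that by (auto simp: order_less_le)
  show ?thesis
  proof (cases "card A = 1")
    \<comment> \<open>Omitting the only factor would leave an empty join. Here \<open>n = 0\<close>,
      so one element is wanted, and the least element serves.\<close>
    case True
    have "jdim b \<noteq> jdim v" using b A(3) True by (simp add: jdim_def zero_enat_def)
    then show ?thesis
      using that[of "\<lambda>_. b"] n True less[OF minimal_le[OF b]] by simp
  next
    case False
    obtain e where e: "inj_on e {..n}" "e ` {..n} \<subseteq> A"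
      using card_le_inj[of "{..n}" A] fin n by auto
    have eA: "e i \<in> A" if "i \<le> n" for i using e(2) that by auto
    have two: "card (A - {a}) = card A - 1" "A - {a} \<noteq> {}" if "a \<in> A" for a
    proof -
      show c: "card (A - {a}) = card A - 1" using that by (rule card_Diff_singleton)
      then have "card (A - {a}) \<noteq> 0" using n False by simp
      then show "A - {a} \<noteq> {}" by force
    qed
    let ?x = "\<lambda>i. Sup_fin (A - {e i})"
    have j: "jdim (?x i) \<noteq> jdim v" if i: "i \<le> n" for i
    proof -
      note two = two[OF eA[OF i]]
      have ac: "irreducible_antichain (A - {e i})"
        using A(1) two by (auto simp: irreducible_antichain_def)
      \<comment> \<open>Otherwise a remaining factor would lie below the omitted \<open>e i\<close>,
        against the antichain property.\<close>
      have "\<not> minimal (?x i)"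
      proof
        assume m: "minimal (?x i)"
        obtain c where c: "c \<in> A - {e i}" using two by blast
        have "c \<le> ?x i" using c fin by (intro Sup_fin.coboundedI) auto
        also have "\<dots> \<le> e i" by (rule minimal_le[OF m])
        finally show False using c eA[OF i] A(1) by (auto simp: irreducible_antichain_def)
      qed
      from jdim_antichain[OF ac this] show ?thesis using A(3) two n by auto
    qed
    have le: "?x i \<le> v" if "i \<le> n" for i
      using Sup_fin.subset_imp[of "A - {e i}" A] two[OF eA[OF that]] fin A(2) by auto
    have "sup (?x i) (?x j) = v" if ij: "i \<le> n" "j \<le> n" "i \<noteq> j" for i j
    proof -
      have "sup (?x i) (?x j) = Sup_fin ((A - {e i}) \<union> (A - {e j}))"
        using two eA ij fin by (intro Sup_fin.union[symmetric]) auto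
      moreover have "(A - {e i}) \<union> (A - {e j}) = A"
        using e(1) ij by (auto simp: inj_on_def)
      ultimately show ?thesis using A(2) by simp
    qed
    then show ?thesis using that[of ?x] j le less by blast
  qed
qed

text \<open>Pigeonhole: if \<open>u\<close> is below no \<open>x i\<close>, each of the
  \<open>n + 1\<close> elements \<open>x i\<close> fails to bound some factor of \<open>u\<close>.
  There are at most \<open>n\<close> factors, so one factor fails for two indices; being prime and
  below \<open>v\<close>, the join of these two elements, it lies below one of them.\<close>

lemma jdim_le_cover:
  fixes v :: "'p::distrib_lattice"
  assumes u: "jdim u \<le> enat n" "u \<le> v"
    and x: "\<And>i j. i \<le> n \<Longrightarrow> j \<le> n \<Longrightarrow> i \<noteq> j \<Longrightarrow> sup (x i) (x j) = v"
  shows "\<exists>i\<le>n. u \<le> x i"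
proof -
  have "jdim u \<noteq> \<infinity>" using u(1) by (cases "jdim u") auto
  then show ?thesis
  proof (cases rule: jdim_finiteE)
    case 1
    then show ?thesis using minimal_le by blast
  next
    case (2 A)
    then have fin: "finite A" "A \<noteq> {}" and c: "card A < card {..n}"
      using u(1) by (auto simp: irreducible_antichain_def)
    show ?thesis
    proof (rule ccontr)
      assume *: "\<not> (\<exists>i\<le>n. u \<le> x i)"
      have "\<exists>a\<in>A. \<not> a \<le> x i" if "i \<le> n" for i
        using * that 2(2) Sup_fin.boundedI[OF fin, of "x i"] by blast
      then obtain c where c': "\<And>i. i \<le> n \<Longrightarrow> c i \<in> A" "\<And>i. i \<le> n \<Longrightarrow> \<not> c i \<le> x i" by metis
      have "\<not> inj_on c {..n}"
        using card_inj_on_le[of c "{..n}" A] c c'(1) fin by auto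
      then obtain i j where ij: "i \<le> n" "j \<le> n" "i \<noteq> j" "c i = c j" by (auto simp: inj_on_def)
      have "c i \<le> sup (x i) (x j)"
        using x[OF ij(1-3)] u(2) 2(2) Sup_fin.coboundedI[OF fin(1) c'(1)[OF ij(1)]] by auto
      moreover have "join_irreducible (c i)" using 2(1) c'(1)[OF ij(1)] by (auto simp: irreducible_antichain_def)
      ultimately show False using join_irreducible_prime c'(2)[OF ij(1)] c'(2)[OF ij(2)] ij(4) by metis
    qed
  qed
qed

section \<open>Cubes of meets\<close>

locale meet_cube =
  fixes v :: "'p::distrib_lattice" and x :: "nat \<Rightarrow> 'p" and n :: nat
  assumes x_less: "i \<le> n \<Longrightarrow> x i < v"
    and x_sup: "i \<le> n \<Longrightarrow> j \<le> n \<Longrightarrow> i \<noteq> j \<Longrightarrow> sup (x i) (x j) = v"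
begin

text \<open>Inserting \<open>v\<close> keeps the meet nonempty and makes \<open>v\<close> the vertex
  at \<open>{0..n}\<close>; elsewhere it changes nothing, as all \<open>x i\<close> are below
  \<open>v\<close>.\<close>

definition vertex :: "nat set \<Rightarrow> 'p" where
  "vertex S = Inf_fin (insert v (x ` ({0..n} - S)))"

lemma le_vertex_iff: "y \<le> vertex S \<longleftrightarrow> y \<le> v \<and> (\<forall>i\<in>{0..n} - S. y \<le> x i)"
  unfolding vertex_def by (subst Inf_fin.bounded_iff) auto

lemma vertex_le: "vertex S \<le> v" "i \<le> n \<Longrightarrow> i \<notin> S \<Longrightarrow> vertex S \<le> x i"
  using le_vertex_iff[of "vertex S" S] by auto

lemma vertex_mono: "S \<subseteq> R \<Longrightarrow> vertex S \<le> vertex R"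
  unfolding le_vertex_iff by (intro conjI ballI vertex_le) auto

lemma vertex_top: "vertex {0..n} = v"
  by (simp add: vertex_def)

lemma vertex_inter: "vertex (S \<inter> R) = inf (vertex S) (vertex R)"
proof (rule order_antisym)
  show "inf (vertex S) (vertex R) \<le> vertex (S \<inter> R)"
    unfolding le_vertex_iff using vertex_le by (auto intro: le_infI1 le_infI2)
qed (simp add: vertex_mono)

lemma sup_Inf_fin_eq:
  fixes a :: 'p
  assumes "finite B" "B \<noteq> {}" "\<And>b. b \<in> B \<Longrightarrow> sup a b = c"
  shows "sup a (Inf_fin B) = c"
  using assms by (induction rule: finite_ne_induct) (auto simp: sup_inf_distrib1)

text \<open>Distributing the join over both meets leaves joins of some \<open>x i\<close> with
  \<open>i\<close> outside \<open>S\<close> and some \<open>x j\<close> with \<open>j\<close>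
  outside \<open>R\<close>. Such a join is \<open>v\<close> unless \<open>i = j\<close>, and then
  \<open>i\<close> is outside \<open>S \<union> R\<close>.\<close>

lemma vertex_union:
  assumes "S \<subseteq> {0..n}" "R \<subseteq> {0..n}"
  shows "vertex (S \<union> R) = sup (vertex S) (vertex R)"
proof (rule order_antisym)
  let ?A = "insert v (x ` ({0..n} - S))" and ?B = "insert v (x ` ({0..n} - R))"
  have "vertex (S \<union> R) \<le> sup a b" if ab: "a \<in> ?A" "b \<in> ?B" for a b
  proof -
    have le: "a \<le> v" "b \<le> v" using ab x_less[THEN order_less_imp_le] by auto
    consider "a = v \<or> b = v" | i j where "i \<le> n" "i \<notin> S" "a = x i" "j \<le> n" "j \<notin> R" "b = x j"
      using ab by auto
    then consider "sup a b = v" | i where "i \<le> n" "i \<notin> S \<union> R" "a = x i" "b = x i"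
    proof cases
      case 1
      then show ?thesis using le that(1) by (auto simp: sup.absorb1 sup.absorb2)
    next
      case (2 i j)
      then show ?thesis using x_sup that by (cases "i = j") auto
    qed
    then show ?thesis using vertex_le by cases auto
  qed
  then have "\<forall>c \<in> {sup a b |a b. a \<in> ?A \<and> b \<in> ?B}. vertex (S \<union> R) \<le> c" by blast
  moreover have "finite {sup a b |a b. a \<in> ?A \<and> b \<in> ?B}"
    by (rule finite_image_set2) simp_all
  moreover have "{sup a b |a b. a \<in> ?A \<and> b \<in> ?B} \<noteq> {}" by blast
  ultimately have "vertex (S \<union> R) \<le> Inf_fin {sup a b |a b. a \<in> ?A \<and> b \<in> ?B}"
    by (intro Inf_fin.boundedI) blast+
  also have "\<dots> = sup (vertex S) (vertex R)"
    unfolding vertex_def by (rule sup_Inf2_distrib[symmetric]) auto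
  finally show "vertex (S \<union> R) \<le> sup (vertex S) (vertex R)" .
qed (simp add: vertex_mono)

text \<open>For \<open>i \<in> S\<close>, the join of \<open>x i\<close> with every element of the
  meet is \<open>v\<close>, so by distributivity its join with the vertex is \<open>v\<close> as
  well. Thus a proper subset \<open>S\<close> can be recovered from its vertex.\<close>

lemma vertex_le_iff:
  assumes "S \<subset> {0..n}" "i \<le> n"
  shows "vertex S \<le> x i \<longleftrightarrow> i \<notin> S"
proof
  assume le: "vertex S \<le> x i"
  show "i \<notin> S"
  proof
    assume "i \<in> S"
    have "sup (x i) (vertex S) = v"
      unfolding vertex_def using x_less[OF assms(2)] \<open>i \<in> S\<close>
      by (intro sup_Inf_fin_eq) (auto simp: sup.absorb2 order_less_imp_le intro!: x_sup[OF assms(2)])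
    then show False using le x_less[OF assms(2)] by (simp add: sup.absorb1)
  qed
qed (use assms vertex_le in auto)

section \<open>The cube as a functor, and its faces\<close>

definition cube :: "('p, 'p \<times> 'p) cube" where
  "cube = poset_functor (Pow {0..n}) vertex (\<lambda>S R. (vertex S, vertex R))"

lemma cube_simps [simp]:
  "S \<subseteq> {0..n} \<Longrightarrow> on_ob cube S = vertex S"
  "S \<subseteq> R \<Longrightarrow> R \<subseteq> {0..n} \<Longrightarrow> on_arr cube (S, R) = (vertex S, vertex R)"
  by (auto simp: cube_def)

lemma cube_cubes: "cube \<in> cubes n (subposet_cat UNIV)"
  unfolding cubes_def cube_def by (rule poset_functor_functors) (auto simp: vertex_mono)

lemma two_elements:
  assumes "card (B - A) \<ge> 2"
  obtains i j where "i \<in> B - A" "j \<in> B - A" "i \<noteq> j"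
proof -
  obtain T where "T \<subseteq> B - A" "card T = 2" using obtain_subset_with_card_n[OF assms] by blast
  then show ?thesis using that by (auto simp: card_2_iff)
qed

text \<open>Limits in a poset are meets and every isomorphism is an identity. With two directions
  \<open>i\<close> and \<open>j\<close> in a face, its initial vertex is already the meet of the
  vertices at \<open>insert i A\<close> and \<open>insert j A\<close>, and its final vertex the join
  of those at \<open>B - {i}\<close> and \<open>B - {j}\<close>.\<close>

lemma cube_strongly_bicartesian: "strongly_bicartesian (subposet_cat UNIV) n cube"
  unfolding strongly_bicartesian_def
proof (intro conjI allI impI cube_cubes)
  fix A B :: "nat set"
  assume AB: "A \<subseteq> B" "B \<subseteq> {0..n}" "card (B - A) \<ge> 2"
  obtain i j where ij: "i \<in> B - A" "j \<in> B - A" "i \<noteq> j" using two_elements[OF AB(3)] .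
  let ?C = "subposet_cat (UNIV :: 'p set)"
  have iso: "is_iso ?C (y, y)" for y by (auto simp: is_iso_def)
  show "cartesian_face ?C cube A B"
  proof -
    let ?J = "{S. A \<subset> S \<and> S \<subseteq> B}"
    have sub: "S \<subseteq> {0..n}" if "S \<in> ?J" for S using that AB by auto
    have "inf (vertex (insert i A)) (vertex (insert j A)) = vertex (insert i A \<inter> insert j A)"
      by (simp add: vertex_inter)
    moreover have "insert i A \<inter> insert j A = A" using ij by auto
    ultimately have A: "vertex A = inf (vertex (insert i A)) (vertex (insert j A))" by simp
    have J: "insert i A \<in> ?J" "insert j A \<in> ?J" using ij AB by auto
    have le: "vertex A \<le> vertex S" if "S \<in> ?J" for S using that by (auto intro: vertex_mono)
    have "limit (subposet_cat ?J) ?C (restrict_functor (subposet_cat ?J) cube) (vertex A)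
      (\<lambda>S. (vertex A, vertex S))"
    proof -
      have "cone (subposet_cat ?J) ?C (restrict_functor (subposet_cat ?J) cube) (vertex A)
        (\<lambda>S. (vertex A, vertex S))"
        using le by (simp add: cone_def sub vertex_mono)
      moreover have "\<exists>!u. u \<in> Hom ?C c (vertex A) \<and>
          (\<forall>S\<in>?J. Comp ?C (vertex A, vertex S) u = \<pi> S)"
        if c: "cone (subposet_cat ?J) ?C (restrict_functor (subposet_cat ?J) cube) c \<pi>" for c \<pi>
      proof -
        have h: "\<pi> S \<in> Hom ?C c (on_ob (restrict_functor (subposet_cat ?J) cube) S)" if "S \<in> ?J" for S
          using c that unfolding cone_def subposet_cat_simps by blast
        have \<pi>: "\<pi> S = (c, vertex S)" "c \<le> vertex S" if "S \<in> ?J" for S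
          using h[OF that] sub[OF that] that by simp_all
        have "c \<le> vertex A" unfolding A using \<pi>(2) J by simp
        then show ?thesis using \<pi>(1) by (intro ex1I[of _ "(c, vertex A)"]) auto
      qed
      ultimately show ?thesis by (simp add: limit_def)
    qed
    then show ?thesis
      unfolding cartesian_face_def Let_def using AB iso
      by (intro exI[of _ "vertex A"] exI[of _ "\<lambda>S. (vertex A, vertex S)"] exI[of _ "(vertex A, vertex A)"]) auto
  qed
  show "cocartesian_face ?C cube A B"
  proof -
    let ?J = "{S. A \<subseteq> S \<and> S \<subset> B}"
    have sub: "S \<subseteq> {0..n}" if "S \<in> ?J" for S using that AB by auto
    have "sup (vertex (B - {i})) (vertex (B - {j})) = vertex ((B - {i}) \<union> (B - {j}))"
      using AB by (intro vertex_union[symmetric]) auto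
    moreover have "(B - {i}) \<union> (B - {j}) = B" using ij by auto
    ultimately have B: "vertex B = sup (vertex (B - {i})) (vertex (B - {j}))" by simp
    have J: "B - {i} \<in> ?J" "B - {j} \<in> ?J" using ij AB by auto
    have le: "vertex S \<le> vertex B" if "S \<in> ?J" for S using that by (auto intro: vertex_mono)
    have "colimit (subposet_cat ?J) ?C (restrict_functor (subposet_cat ?J) cube) (vertex B)
      (\<lambda>S. (vertex S, vertex B))"
    proof -
      have "cocone (subposet_cat ?J) ?C (restrict_functor (subposet_cat ?J) cube) (vertex B)
        (\<lambda>S. (vertex S, vertex B))"
        using le by (simp add: cocone_def sub vertex_mono)
      moreover have "\<exists>!u. u \<in> Hom ?C (vertex B) c \<and>
          (\<forall>S\<in>?J. Comp ?C u (vertex S, vertex B) = \<pi> S)"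
        if c: "cocone (subposet_cat ?J) ?C (restrict_functor (subposet_cat ?J) cube) c \<pi>" for c \<pi>
      proof -
        have h: "\<pi> S \<in> Hom ?C (on_ob (restrict_functor (subposet_cat ?J) cube) S) c" if "S \<in> ?J" for S
          using c that unfolding cocone_def subposet_cat_simps by blast
        have \<pi>: "\<pi> S = (vertex S, c)" "vertex S \<le> c" if "S \<in> ?J" for S
          using h[OF that] sub[OF that] that by simp_all
        have "vertex B \<le> c" unfolding B using \<pi>(2) J by simp
        then show ?thesis using \<pi>(1) by (intro ex1I[of _ "(vertex B, c)"]) auto
      qed
      ultimately show ?thesis by (simp add: colimit_def)
    qed
    then show ?thesis
      unfolding cocartesian_face_def Let_def using AB iso
      by (intro exI[of _ "vertex B"] exI[of _ "\<lambda>S. (vertex S, vertex B)"] exI[of _ "(vertex B, vertex B)"]) auto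
  qed
qed

end

section \<open>The codegree approximation\<close>

text \<open>One step of the descent: \<open>W\<close> is the induction hypothesis and
  \<open>cover\<close> is what the bound on the join-dimension over \<open>I\<close> provides. As
  \<open>homotopy_cocartesian\<close> speaks of every cofibrant replacement, it can be applied to
  the restriction of \<open>T\<close> with the components of \<open>e\<close>; the resulting
  comparison map is \<open>e v\<close>.\<close>

lemma codegree_weak_equivalence_step:
  assumes cube: "meet_cube v x n"
    and kan: "kan_extension M t I Q T \<eta>" and model: "model_category U M" and z: "initial M z"
    and Q: "cofibrant (projective (subposet_cat I) M) Q"
    and F: "F \<in> functors (subposet_cat UNIV) M" and codeg: "codegree M n F"
    and e: "natural_on M UNIV T F e"
    and W: "\<And>S. S \<subset> {0..n} \<Longrightarrow> e (meet_cube.vertex v x n S) \<in> Weq M"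
    and cover: "\<And>u. u \<in> I \<Longrightarrow> u \<le> v \<Longrightarrow> \<exists>i\<le>n. u \<le> x i"
  shows "e v \<in> Weq M"
proof -
  interpret cube: meet_cube v x n by (rule cube)
  interpret kan: kan_extension M t I Q T \<eta> by (rule kan)
  let ?K = "{S. S \<subset> {0..n}}" and ?D = "{y. \<exists>i\<le>n. y \<le> x i}"
  \<comment> \<open>For \<open>y \<le> v\<close>, being below the vertex at \<open>S\<close> means
    that \<open>S\<close> contains every \<open>i\<close> with \<open>y\<close> not below
    \<open>x i\<close>. For \<open>y\<close> in \<open>?D\<close> this set of indices is
    proper.\<close>
  let ?\<phi> = "\<lambda>y. {i \<in> {0..n}. \<not> y \<le> x i}"
  interpret R: model_kan_along_reflection M t I Q T \<eta> ?K cube.vertex ?D ?\<phi> U z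
  proof unfold_locales
    show "down_closed ?D" by (auto simp: down_closed_def intro: order_trans)
    show "mono_on ?K cube.vertex" by (auto intro!: mono_onI cube.vertex_mono)
    show "mono_on ?D ?\<phi>" by (auto intro!: mono_onI intro: order_trans)
  next
    fix S assume S: "S \<in> ?K"
    then show "cube.vertex S \<in> ?D" using cube.vertex_le(2)[of _ S] by fastforce
    show "?\<phi> (cube.vertex S) = S" using S cube.vertex_le_iff[of S] by (auto 0 3)
  next
    fix y assume y: "y \<in> ?D"
    then obtain i where "i \<in> {0..n}" "y \<le> x i" by auto
    then show "?\<phi> y \<in> ?K" by blast
    have "y \<le> v" using y cube.x_less by (auto dest: order_less_imp_le intro: order_trans)
    then show "y \<le> cube.vertex (?\<phi> y)" by (auto simp: cube.le_vertex_iff)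
  qed (rule model z)+
  let ?J = "subposet_cat ?K" and ?X = "functor_comp (subposet_cat (Pow {0..n})) F cube.cube"
  have X_ob: "on_ob ?X S = on_ob F (cube.vertex S)" if "S \<subseteq> {0..n}" for S
    using that by (simp add: functor_comp_def)
  have X_arr: "on_arr ?X (S, R) = on_arr F (cube.vertex S, cube.vertex R)" if "S \<subseteq> R" "R \<subseteq> {0..n}" for S R
    using that by (auto simp: functor_comp_def)
  have "homotopy_cocartesian M n ?X"
    using codeg cube.cube_strongly_bicartesian by (simp add: codegree_def)
  note hc = this[unfolded homotopy_cocartesian_def Let_def, rule_format]
  have eh: "e y \<in> Hom M (on_ob T y) (on_ob F y)" for y
    using natural_on_hom[OF e] by simp
  have rX: "restrict_functor ?J ?X \<in> functors ?J M"
  proof -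
    have "restrict_functor ?J ?X =
        poset_functor ?K (\<lambda>S. on_ob F (cube.vertex S)) (\<lambda>S R. on_arr F (cube.vertex S, cube.vertex R))"
      unfolding restrict_functor_def poset_functor_def functr.inject
      by (intro conjI, simp_all, (rule restrict_ext; auto simp: X_ob X_arr)+)
    then show ?thesis using pullback_functor[OF F _ R.g_mono] by auto
  qed
  let ?q = "NatTrans R.TK (restrict_functor ?J ?X) (\<lambda>S\<in>?K. e (cube.vertex S))"
  have q: "?q \<in> Hom (fun_cat ?J M) R.TK (restrict_functor ?J ?X)"
  proof (rule Hom_fun_catI[OF R.TK_functor rX])
    show "natural_on M ?K R.TK (restrict_functor ?J ?X) (\<lambda>S. e (cube.vertex S))"
      using eh natural_on_eq[OF e] R.g_le by (intro natural_onI) (auto simp: X_ob X_arr psubset_imp_subset)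
  qed
  then have "?q \<in> Weq (projective ?J M)"
    using W by (auto simp: projective_def Let_def Hom_def)
  then have rep: "cofibrant_replacement (projective ?J M) (restrict_functor ?J ?X) R.TK ?q"
    using R.cofibrant_TK[OF Q] q by (simp add: cofibrant_replacement_def Hom_projective)
  have col: "colimit ?J M R.TK (on_ob T v) (\<lambda>S. on_arr T (cube.vertex S, v))"
    using cover cube.x_less by (intro R.colimit_TK) (auto dest: order_less_imp_le intro: order_trans)
  show ?thesis
  \<comment> \<open>The map induced on the colimit has to agree with \<open>e v\<close> on each
    vertex, which is naturality of \<open>e\<close> along the arrow to \<open>v\<close>.\<close>
  proof (rule hc[OF rep col])
    show "e v \<in> Hom M (on_ob T v) (on_ob ?X {0..n})"
      using eh X_ob[of "{0..n}"] by (simp add: cube.vertex_top)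
  next
    fix S assume "S \<in> Ob ?J"
    then show "Comp M (e v) (on_arr T (cube.vertex S, v)) =
        Comp M (on_arr ?X (S, {0..n})) (component ?q S)"
      using natural_on_eq[OF e, of "cube.vertex S" v] cube.vertex_le
      by (simp add: X_arr psubset_imp_subset cube.vertex_top)
  qed
qed

theorem theorem2:
  fixes M :: "('o, 'a) model_cat"
    and F T :: "('p::distrib_lattice, 'p \<times> 'p, 'o, 'a) functr"
    and \<epsilon> :: "('p, 'p \<times> 'p, 'o, 'a) nattrans"
    and n :: nat
    and emb :: "'p \<Rightarrow> 'i"
  assumes "join_factorization_lattice TYPE('p) TYPE('q::distrib_lattice)"
    and "infinite (UNIV :: 'i set)" and "inj emb"
    and "good_model_category TYPE('i) M"
    and "F \<in> functors (subposet_cat UNIV) M"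
    and "codegree M n F"
    and "codegree_approximation M n F T \<epsilon>"
  shows "objectwise_weak_equivalence (subposet_cat UNIV) M \<epsilon>"
proof -
  let ?I = "jdim_le n :: 'p set"
  have model: "model_category TYPE('i) M"
    using assms(4) by (simp add: good_model_category_def)
  obtain t z where t: "terminal M t" and z: "initial M z"
    using model_category_terminal_initial[OF model] .
  obtain Q q \<eta> where rep: "cofibrant_replacement (projective (subposet_cat ?I) M) (restrict_functor (subposet_cat ?I) F) Q q"
    and kan: "left_kan_extension (subposet_cat ?I) (subposet_cat UNIV) M Q T \<eta>"
    and \<epsilon>: "\<epsilon> \<in> Hom (fun_cat (subposet_cat UNIV) M) T F"
    and \<epsilon>\<eta>: "Comp (fun_cat (subposet_cat ?I) M) (restrict_nattrans (subposet_cat ?I) \<epsilon>) \<eta> = q"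
    using assms(7) unfolding codegree_approximation_def Let_def by blast
  interpret kan_extension M t ?I Q T \<eta>
    by unfold_locales (rule model_category_category[OF model] t kan)+
  have e: "natural_on M UNIV T F (component \<epsilon>)"
    using \<epsilon> by (simp add: Hom_fun_cat_iff)
  \<comment> \<open>On \<open>?I\<close> the unit is an isomorphism and \<open>q\<close> is
    \<open>\<epsilon>\<close> after the unit, so two-out-of-three applies.\<close>
  have base: "component \<epsilon> v \<in> Weq M" if v: "v \<in> ?I" for v
  proof -
    have h: "component \<eta> v \<in> Hom M (on_ob Q v) (on_ob T v)" "component \<epsilon> v \<in> Hom M (on_ob T v) (on_ob F v)"
      using natural_on_hom[OF unit_natural v] natural_on_hom[OF e] by auto
    obtain \<beta> where "\<beta> \<in> Hom M (on_ob T v) (on_ob Q v)"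
      "Comp M \<beta> (component \<eta> v) = Ide M (on_ob Q v)" "Comp M (component \<eta> v) \<beta> = Ide M (on_ob T v)"
      using unit_iso[OF v] .
    then have "component \<eta> v \<in> Weq M"
      by (rule model_category_iso[OF model h(1)])
    moreover have "component q v = Comp M (component \<epsilon> v) (component \<eta> v)"
      using component_Comp_fun_cat[OF v, of M "restrict_nattrans (subposet_cat ?I) \<epsilon>" \<eta>] v \<epsilon>\<eta> by simp
    moreover have "component q v \<in> Weq M"
      using rep v by (auto simp: cofibrant_replacement_def projective_def Let_def)
    ultimately show ?thesis
      using model h unfolding model_category_def two_of_three_def by (auto simp: Hom_def)
  qed
  obtain b :: 'p and f :: "'p \<Rightarrow> 'q" where b: "minimal b" and f: "mono f" "\<And>v. jdim (f v) = jdim v"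
    and dcc: "\<And>A :: 'q set. A \<noteq> {} \<Longrightarrow> \<exists>m\<in>A. \<forall>y\<in>A. \<not> y < m"
    using assms(1) unfolding join_factorization_lattice_def by blast
  \<comment> \<open>Finiteness holds in the lattice with the chain condition and is pulled back
    along \<open>f\<close>.\<close>
  have fin: "jdim v \<noteq> \<infinity>" for v :: 'p
    using finite_jdim_dcc[OF dcc, of "f v"] f(2) by simp
  have "component \<epsilon> v \<in> Weq M" for v
  proof (rule ccontr)
    assume "component \<epsilon> v \<notin> Weq M"
    \<comment> \<open>The minimal element is taken in the image under \<open>f\<close>, so the
      induction hypothesis concerns every \<open>y\<close> with \<open>f y < f v\<close>, whether or
      not it is below \<open>v\<close>.\<close>
    then have "f ` {v. component \<epsilon> v \<notin> Weq M} \<noteq> {}" by blast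
    from dcc[OF this] obtain v where v: "component \<epsilon> v \<notin> Weq M"
      and less: "\<And>y. f y < f v \<Longrightarrow> component \<epsilon> y \<in> Weq M" by blast
    have "v \<notin> ?I" using base v by blast
    then have "enat n < jdim v" by (simp add: jdim_le_def not_le)
    from jdim_cover[OF b this fin] obtain x where x: "\<And>i. i \<le> n \<Longrightarrow> x i < v"
      "\<And>i. i \<le> n \<Longrightarrow> jdim (x i) \<noteq> jdim v"
      "\<And>i j. i \<le> n \<Longrightarrow> j \<le> n \<Longrightarrow> i \<noteq> j \<Longrightarrow> sup (x i) (x j) = v" by metis
    interpret cube: meet_cube v x n by unfold_locales (rule x; assumption)+
    have "component \<epsilon> v \<in> Weq M"
    proof (rule codegree_weak_equivalence_step[OF cube.meet_cube_axioms kan_extension_axioms model z _ assms(5,6) e])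
      show "cofibrant (projective (subposet_cat ?I) M) Q"
        using rep by (simp add: cofibrant_replacement_def)
    next
      fix S assume "S \<subset> {0..n}"
      then obtain i where "i \<in> {0..n}" "i \<notin> S" by blast
      then have i: "i \<le> n" "i \<notin> S" by simp_all
      have "f (cube.vertex S) \<le> f (x i)" using f(1) cube.vertex_le(2)[OF i] by (simp add: monoD)
      also have "f (x i) \<noteq> f v" using x(2)[OF i(1)] f(2) by metis
      then have "f (x i) < f v" using f(1) x(1)[OF i(1)] by (simp add: monoD order_less_le)
      finally show "component \<epsilon> (cube.vertex S) \<in> Weq M" by (rule less)
    next
      fix u assume "u \<in> ?I" "u \<le> v"
      then show "\<exists>i\<le>n. u \<le> x i" using jdim_le_cover[of u n v x] x(3) by (simp add: jdim_le_def)
    qed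
    with v show False ..
  qed
  then show ?thesis by (simp add: objectwise_weak_equivalence_def)
qed

end
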